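(* Any solution $(\rho^n,\boldsymbol u^n,\phi^n)_{0\le n\le N}$ of the scheme (M), (U), (P) of the context satisfies, for $0\le n\le N-1$, the global energy inequality $$\sum_{i=1}^d\sum_{\sigma\in\mathcal E^{(i)}_{\mathrm{int}}}\frac12\frac{|D_\sigma|}{\delta t}\big(\rho^{n+1}_{D_\sigma}(u^{n+1}_\sigma)^2-\rho^n_{D_\sigma}(u^n_\sigma)^2\big)+\sum_{K\in\mathcal M}\frac{|K|}{\delta t}\big(e^{\phi^{n+1}_K}(\phi^{n+1}_K-1)-e^{\phi^n_K}(\phi^n_K-1)\big)+\frac{\varepsilon^2}2\sum_{i=1}^d\sum_{\sigma\in\mathcal E^{(i)}_{\mathrm{int}}}\frac{|D_\sigma|}{\delta t}\big(|(\partial^{(i)}_{\mathcal E}\phi^{n+1})_\sigma|^2-|(\partial^{(i)}_{\mathcal E}\phi^n)_\sigma|^2\big)\le0$$ under the following conditions. (i) A CFL restriction on the time-step (for all $K\in\mathcal M$ and internal $\sigma\in\mathcal E(K)$): $$\delta t\le\min\Big\{\frac{\rho^{n+1}_{D_\sigma}|D_\sigma|}{4\sum_{\epsilon\in\tilde{\mathcal E}(D_\sigma)}\big(-(F^n_{\epsilon,\sigma})^-\big)},\ \frac12\Big(\frac1{\alpha^n_{K,\sigma}}\Big)^{1/2}\Big\},\qquad \alpha^n_{K,\sigma}=\frac{|\partial K|}{|K|}\frac{|\sigma|}{|D_\sigma|}\frac1{\rho^{n+1}_{D_\sigma}}.$$ (ii) The following choices for the stabilisation terms: $$Q^{n+1}_\sigma=\eta\,\delta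 t\,(\partial^{(i)}_{\mathcal E}\phi^{n+1})_\sigma,\ \ \forall\sigma\in\mathcal E^{(i)}_{\mathrm{int}},\ 1\le i\le d,\qquad \Lambda^n_K=\frac{\delta t}{|K|}\sum_{\sigma\in\mathcal E(K)}|\sigma|u^n_{\sigma,K},\ \ \forall K\in\mathcal M,$$ with $\eta\ge\dfrac{(\rho^n_\sigma)^2}{\rho^{n+1}_{D_\sigma}}$ for each $\sigma\in\mathcal E^{(i)}_{\mathrm{int}}$, $1\le i\le d$.
   Context: MAC grid. $\Omega\subset\mathbb R^d$, $d=1,2,3$, is open, bounded, connected, and $\bar\Omega$ is a union of closed rectangles ($d=2$) or closed orthogonal parallelepipeds ($d=3$; intervals if $d=1$) with mutually disjoint interiors and edges (faces) orthogonal to the canonical basis vectors $\boldsymbol e^{(1)},\dots,\boldsymbol e^{(d)}$. A MAC grid $(\mathcal M,\mathcal E)$ consists of a partition $\mathcal M$ of $\bar\Omega$ into possibly non-uniform closed cells of this type (primal cells) and the set $\mathcal E$ of all their edges; $\mathcal E_{\mathrm{int}},\mathcal E_{\mathrm{ext}}$ are the internal and external edges, $\mathcal E^{(i)}$ the edges orthogonal to $\boldsymbol e^{(i)}$, $\mathcal E^{(i)}_{\mathrm{int}}=\mathcal E^{(i)}\cap\mathcal E_{\mathrm{int}}$, $\mathcal E(K)$ the edges of $K$. $\sigma=K|L$ means that $\sigma=K\cap L$ is internal. $D_{\sigma,K}$ is the half of $K$ adjacent to $\sigma$; the dual cell is $D_\sigma=D_{\sigma,K}\cup D_{\sigma,L}$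 for $\sigma=K|L$, and $D_\sigma=D_{\sigma,K}$ for $\sigma\in\mathcal E_{\mathrm{ext}}$ adjacent to $K$. $\tilde{\mathcal E}(D_\sigma)$ is the set of edges of $D_\sigma$; $\epsilon=D_\sigma|D_{\sigma'}$ denotes an edge separating two dual cells. $|\cdot|$ is the $d$- or $(d-1)$-dimensional measure, $|\partial K|=\sum_{\sigma\in\mathcal E(K)}|\sigma|$; $\boldsymbol\nu_{\sigma,K}$ is the unit normal to $\sigma$ outward to $K$. Spaces. $L_{\mathcal M}(\Omega)$: functions constant on each $K\in\mathcal M$ (values $q_K$). $\boldsymbol H_{\mathcal E,0}(\Omega)$: vector functions whose $i$-th component is constant on each $D_\sigma$, $\sigma\in\mathcal E^{(i)}$ (values $v_\sigma$), and vanishes on external edges. $v_{\sigma,K}=v_\sigma\boldsymbol e^{(i)}\cdot\boldsymbol\nu_{\sigma,K}$ for $\sigma\in\mathcal E^{(i)}\cap\mathcal E(K)$. Dual average: $|D_\sigma|q_{D_\sigma}=|D_{\sigma,K}|q_K+|D_{\sigma,L}|q_L$ for $\sigma=K|L$. Discrete operators. $(\partial^{(i)}_{\mathcal E}q)_\sigma=\frac{|\sigma|}{|D_\sigma|}(q_L-q_K)\boldsymbol e^{(i)}\cdot\boldsymbol\nu_{\sigma,K}$ for $\sigma=K|L\in\mathcal E^{(i)}_{\mathrm{int}}$, and $0$ on external edges; $\nabla_{\mathcal E}q=(\partial^{(1)}_{\mathcal E}q,\dots,\partial^{(d)}_{\mathcal E}q)$; $(\mathrm{div}_{\mathcal M}\boldsymbol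 v)_K=\frac1{|K|}\sum_{\sigma\in\mathcal E(K)}|\sigma|v_{\sigma,K}$; $\Delta_{\mathcal M}q=\mathrm{div}_{\mathcal M}(\nabla_{\mathcal E}q)$. Scheme. $0=t_0<\dots<t_N=T$ with constant step $\delta t$; $\varepsilon\in(0,1]$. The unknowns are $\rho^n,\phi^n\in L_{\mathcal M}(\Omega)$ with $\rho^n>0$, and $\boldsymbol u^n\in\boldsymbol H_{\mathcal E,0}(\Omega)$. For $\sigma=K|L$, $\rho_\sigma=\frac{\rho_K-\rho_L}{\ln\rho_K-\ln\rho_L}$ if $\rho_K\ne\rho_L$, and $\rho_\sigma=\rho_K$ otherwise. With stabilisation terms $Q^{n+1}\in\boldsymbol H_{\mathcal E,0}(\Omega)$ and $\Lambda^n\in L_{\mathcal M}(\Omega)$, the mass flux is $F^n_{\sigma,K}=|\sigma|(\rho^n_\sigma u^n_{\sigma,K}-Q^{n+1}_{\sigma,K})$ (zero on external edges). The dual flux $F^n_{\epsilon,\sigma}$ across $\epsilon\in\tilde{\mathcal E}(D_\sigma)$ (outward to $D_\sigma$) is a suitable linear combination, with constant coefficients, of the primal mass fluxes at the neighbouring edges if $\epsilon$ is internal, and $0$ otherwise, such that averaging (M) over a dual cell gives $\frac1{\delta t}(\rho^{n+1}_{D_\sigma}-\rho^n_{D_\sigma})+\frac1{|D_\sigma|}\sum_{\epsilon\in\tilde{\mathcal E}(D_\sigma)}F^n_{\epsilon,\sigma}=0$ (in the usual MAC choice, for $\sigma=K|L\in\mathcal E^{(i)}_{\mathrm{int}}$: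 if $\epsilon\subset K$ separates $\sigma$ from the opposite face $\sigma'$ of $K$, $F_{\epsilon,\sigma}=\frac12(F_{\sigma',K}-F_{\sigma,K})$; if $\epsilon$ is made of halves of faces $\tau$ of $K$ and $\tau'$ of $L$ not orthogonal to $\boldsymbol e^{(i)}$, $F_{\epsilon,\sigma}=\frac12(F_{\tau,K}+F_{\tau',L})$). Upwind velocity: for $\epsilon=D_\sigma|D_{\sigma'}$, $u_{\epsilon,\mathrm{up}}=u_\sigma$ if $F_{\epsilon,\sigma}\ge0$, $u_{\sigma'}$ otherwise. For $0\le n\le N-1$: (M) $\frac1{\delta t}(\rho^{n+1}_K-\rho^n_K)+\frac1{|K|}\sum_{\sigma\in\mathcal E(K)}F^n_{\sigma,K}=0$, for all $K\in\mathcal M$; (U) $\frac1{\delta t}(\rho^{n+1}_{D_\sigma}u^{n+1}_\sigma-\rho^n_{D_\sigma}u^n_\sigma)+\frac1{|D_\sigma|}\sum_{\epsilon\in\tilde{\mathcal E}(D_\sigma)}F^n_{\epsilon,\sigma}u^n_{\epsilon,\mathrm{up}}=-\rho^n_\sigma(\partial^{(i)}_{\mathcal E}\phi^{n+1})_\sigma+(\partial^{(i)}_{\mathcal E}\Lambda^n)_\sigma$, for $1\le i\le d$, $\sigma\in\mathcal E^{(i)}_{\mathrm{int}}$; (P) $-\varepsilon^2(\Delta_{\mathcal M}\phi^{n+1})_K=\rho^{n+1}_K-e^{\phi^{n+1}_K}$, for all $K\in\mathcal M$. Initialisation from given data $(\rho_0,\boldsymbol u_0,\phi_0)$: $\rho^0_K=\frac1{|K|}\int_K\rho_0$,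 $\phi^0_K=\frac1{|K|}\int_K\phi_0$, $u^0_\sigma=\frac1{|D_\sigma|}\int_{D_\sigma}(\boldsymbol u_0)_i$ for $\sigma\in\mathcal E^{(i)}_{\mathrm{int}}$. Notation: $a^-=\frac12(a-|a|)$.
   Formalization: For n = 0 it is additionally assumed that (P) holds at time level 0 (the claim fails otherwise, e.g. one cell, ρ₀=2, φ₀=0); Ω is taken without slits, the grid conforming, and dual fluxes conservative across edges between internal dual cells. *)

theory Defs
  imports "HOL-Analysis.Analysis"
begin

section \<open>MAC grids\<close>

text \<open>
  Cells are closed boxes in the Euclidean space of dimension \<open>CARD('d)\<close>; the \<open>i\<close>-th canonical basis
  vector is \<^term>\<open>axis i 1\<close>.  A piecewise constant function on the primal cells is represented by
  the family of its cell values \<open>q K\<close>; a vector field whose \<open>i\<close>-th component is constant on each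
  dual cell of an edge orthogonal to \<open>axis i 1\<close> by the family of its edge values \<open>v \<sigma>\<close> (an edge
  is orthogonal to exactly one basis vector, so \<open>\<sigma>\<close> determines the component).
\<close>

type_synonym 'd cell = "(real ^ 'd) set"
type_synonym 'd edge = "(real ^ 'd) set"

abbreviation vol :: "(real ^ 'd::finite) set \<Rightarrow> real" where
  "vol \<equiv> measure lebesgue"

definition lower_face :: "'d::finite \<Rightarrow> 'd cell \<Rightarrow> 'd edge" where
  "lower_face i K = {x \<in> K. x $ i = interval_lowerbound K $ i}"

definition upper_face :: "'d::finite \<Rightarrow> 'd cell \<Rightarrow> 'd edge" where
  "upper_face i K = {x \<in> K. x $ i = interval_upperbound K $ i}"

definition cell_edges_dir :: "'d::finite \<Rightarrow> 'd cell \<Rightarrow> 'd edge set" where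
  "cell_edges_dir i K = {lower_face i K, upper_face i K}"

definition cell_edges :: "'d::finite cell \<Rightarrow> 'd edge set" where
  "cell_edges K = (\<Union>i. cell_edges_dir i K)"

definition grid_edges_dir :: "'d::finite cell set \<Rightarrow> 'd \<Rightarrow> 'd edge set" where
  "grid_edges_dir M i = (\<Union>K\<in>M. cell_edges_dir i K)"

definition grid_edges :: "'d::finite cell set \<Rightarrow> 'd edge set" where
  "grid_edges M = (\<Union>i. grid_edges_dir M i)"

definition ext_edges :: "(real ^ 'd::finite) set \<Rightarrow> 'd cell set \<Rightarrow> 'd edge set" where
  "ext_edges \<Omega> M = {\<sigma> \<in> grid_edges M. \<sigma> \<subseteq> frontier \<Omega>}"

definition int_edges :: "(real ^ 'd::finite) set \<Rightarrow> 'd cell set \<Rightarrow> 'd edge set" where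
  "int_edges \<Omega> M = grid_edges M - ext_edges \<Omega> M"

definition int_edges_dir :: "(real ^ 'd::finite) set \<Rightarrow> 'd cell set \<Rightarrow> 'd \<Rightarrow> 'd edge set" where
  "int_edges_dir \<Omega> M i = grid_edges_dir M i \<inter> int_edges \<Omega> M"

text \<open>\<open>\<sigma> = K|L\<close>:\<close>

definition edge_between ::
  "(real ^ 'd::finite) set \<Rightarrow> 'd cell set \<Rightarrow> 'd edge \<Rightarrow> 'd cell \<Rightarrow> 'd cell \<Rightarrow> bool" where
  "edge_between \<Omega> M \<sigma> K L \<longleftrightarrow>
     \<sigma> \<in> int_edges \<Omega> M \<and> K \<in> M \<and> L \<in> M \<and> K \<noteq> L \<and>
     \<sigma> \<in> cell_edges K \<and> \<sigma> \<in> cell_edges L \<and> \<sigma> = K \<inter> L"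

text \<open>
  \<^term>\<open>(division_of)\<close> says that \<open>M\<close> is a finite set of closed boxes with pairwise disjoint interiors
  and union \<open>closure \<Omega>\<close>.  The condition \<open>interior (closure \<Omega>) = \<Omega>\<close> excludes slits, whose two
  sides would be boundary edges with cells on either side; the last condition is conformity of the
  grid (no hanging nodes).
\<close>

definition mac_grid :: "(real ^ 'd::finite) set \<Rightarrow> 'd cell set \<Rightarrow> bool" where
  "mac_grid \<Omega> M \<longleftrightarrow>
     open \<Omega> \<and> bounded \<Omega> \<and> connected \<Omega> \<and> interior (closure \<Omega>) = \<Omega> \<and>
     M division_of (closure \<Omega>) \<and> (\<forall>K\<in>M. interior K \<noteq> {}) \<and>
     (\<forall>\<sigma>\<in>int_edges \<Omega> M. \<exists>K L. edge_between \<Omega> M \<sigma> K L)"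

text \<open>The index \<open>i\<close> such that the edge is orthogonal to \<^term>\<open>axis i 1\<close>:\<close>

definition edge_dir :: "'d::finite edge \<Rightarrow> 'd" where
  "edge_dir \<sigma> = (THE i. interval_lowerbound \<sigma> $ i = interval_upperbound \<sigma> $ i)"

text \<open>
  \<open>(d-1)\<close>-dimensional measure of an edge: the product of its side lengths in the directions other
  than its normal (equal to \<open>1\<close> if \<open>d = 1\<close>).
\<close>

definition area :: "'d::finite edge \<Rightarrow> real" where
  "area \<sigma> = (\<Prod>j\<in>UNIV - {edge_dir \<sigma>}. interval_upperbound \<sigma> $ j - interval_lowerbound \<sigma> $ j)"

definition perimeter :: "'d::finite cell \<Rightarrow> real" where
  "perimeter K = (\<Sum>\<sigma>\<in>cell_edges K. area \<sigma>)"

definition outer_normal :: "'d::finite edge \<Rightarrow> 'd cell \<Rightarrow> real ^ 'd" where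
  "outer_normal \<sigma> K =
     (if \<sigma> = upper_face (edge_dir \<sigma>) K then axis (edge_dir \<sigma>) 1 else - axis (edge_dir \<sigma>) 1)"

definition half_cell :: "'d::finite edge \<Rightarrow> 'd cell \<Rightarrow> (real ^ 'd) set" where
  "half_cell \<sigma> K =
     (let i = edge_dir \<sigma>; m = (interval_lowerbound K $ i + interval_upperbound K $ i) / 2
      in {x \<in> K. if \<sigma> = upper_face i K then m \<le> x $ i else x $ i \<le> m})"

definition dual_cell :: "'d::finite cell set \<Rightarrow> 'd edge \<Rightarrow> 'd cell" where
  "dual_cell M \<sigma> = (\<Union>K\<in>{K \<in> M. \<sigma> \<in> cell_edges K}. half_cell \<sigma> K)"

text \<open>
  \<open>\<epsilon> = D\<^sub>\<sigma>|D\<^sub>\<sigma>\<^sub>'\<close>: the dual cell of \<open>\<sigma>'\<close> (for the same velocity component) touches the edge \<open>\<epsilon>\<close>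
  of the dual cell of \<open>\<sigma>\<close> along a \<open>(d-1)\<close>-dimensional set.  The set may be only half of \<open>\<epsilon>\<close>, which
  happens at re-entrant corners of the domain (and then \<open>\<sigma>'\<close> is external).
\<close>

definition dual_edge_between ::
  "'d::finite cell set \<Rightarrow> 'd edge \<Rightarrow> 'd edge \<Rightarrow> 'd edge \<Rightarrow> bool" where
  "dual_edge_between M \<epsilon> \<sigma> \<sigma>' \<longleftrightarrow>
     (\<exists>i. \<sigma> \<in> grid_edges_dir M i \<and> \<sigma>' \<in> grid_edges_dir M i) \<and> \<sigma> \<noteq> \<sigma>' \<and>
     \<epsilon> \<in> cell_edges (dual_cell M \<sigma>) \<and>
     aff_dim (\<epsilon> \<inter> dual_cell M \<sigma>') = int CARD('d) - 1"


section \<open>Discrete operators\<close>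

text \<open>The value \<open>v\<^sub>\<sigma>\<^sub>,\<^sub>K\<close> of the field in the direction of the outward normal:\<close>

definition normal_value :: "('d::finite edge \<Rightarrow> real) \<Rightarrow> 'd edge \<Rightarrow> 'd cell \<Rightarrow> real" where
  "normal_value v \<sigma> K = v \<sigma> * (axis (edge_dir \<sigma>) 1 \<bullet> outer_normal \<sigma> K)"

text \<open>
  Some ordering \<open>(K, L)\<close> of the two cells of an internal edge \<open>\<sigma> = K|L\<close>.  All expressions below that
  use it are invariant under exchanging \<open>K\<close> and \<open>L\<close>.
\<close>

definition adjacent_cells ::
  "(real ^ 'd::finite) set \<Rightarrow> 'd cell set \<Rightarrow> 'd edge \<Rightarrow> 'd cell \<times> 'd cell" where
  "adjacent_cells \<Omega> M \<sigma> = (SOME (K, L). edge_between \<Omega> M \<sigma> K L)"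

definition dual_average ::
  "(real ^ 'd::finite) set \<Rightarrow> 'd cell set \<Rightarrow> ('d cell \<Rightarrow> real) \<Rightarrow> 'd edge \<Rightarrow> real" where
  "dual_average \<Omega> M q \<sigma> =
     (case adjacent_cells \<Omega> M \<sigma> of (K, L) \<Rightarrow>
        (vol (half_cell \<sigma> K) * q K + vol (half_cell \<sigma> L) * q L) / vol (dual_cell M \<sigma>))"

definition edge_deriv ::
  "(real ^ 'd::finite) set \<Rightarrow> 'd cell set \<Rightarrow> ('d cell \<Rightarrow> real) \<Rightarrow> 'd edge \<Rightarrow> real" where
  "edge_deriv \<Omega> M q \<sigma> =
     (if \<sigma> \<in> int_edges \<Omega> M then
        (case adjacent_cells \<Omega> M \<sigma> of (K, L) \<Rightarrow>
           area \<sigma> / vol (dual_cell M \<sigma>) * (q L - q K) * (axis (edge_dir \<sigma>) 1 \<bullet> outer_normal \<sigma> K))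
      else 0)"

definition cell_div :: "('d::finite edge \<Rightarrow> real) \<Rightarrow> 'd cell \<Rightarrow> real" where
  "cell_div v K = 1 / vol K * (\<Sum>\<sigma>\<in>cell_edges K. area \<sigma> * normal_value v \<sigma> K)"

definition cell_laplacian ::
  "(real ^ 'd::finite) set \<Rightarrow> 'd cell set \<Rightarrow> ('d cell \<Rightarrow> real) \<Rightarrow> 'd cell \<Rightarrow> real" where
  "cell_laplacian \<Omega> M q K = cell_div (edge_deriv \<Omega> M q) K"

definition vanishes_ext ::
  "(real ^ 'd::finite) set \<Rightarrow> 'd cell set \<Rightarrow> ('d edge \<Rightarrow> real) \<Rightarrow> bool" where
  "vanishes_ext \<Omega> M v \<longleftrightarrow> (\<forall>\<sigma>\<in>ext_edges \<Omega> M. v \<sigma> = 0)"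


section \<open>Mass fluxes\<close>

definition log_mean :: "real \<Rightarrow> real \<Rightarrow> real" where
  "log_mean a b = (if a \<noteq> b then (a - b) / (ln a - ln b) else a)"

definition edge_density ::
  "(real ^ 'd::finite) set \<Rightarrow> 'd cell set \<Rightarrow> ('d cell \<Rightarrow> real) \<Rightarrow> 'd edge \<Rightarrow> real" where
  "edge_density \<Omega> M r \<sigma> = (case adjacent_cells \<Omega> M \<sigma> of (K, L) \<Rightarrow> log_mean (r K) (r L))"

definition mass_flux ::
  "(real ^ 'd::finite) set \<Rightarrow> 'd cell set \<Rightarrow> ('d cell \<Rightarrow> real) \<Rightarrow> ('d edge \<Rightarrow> real) \<Rightarrow>
   ('d edge \<Rightarrow> real) \<Rightarrow> 'd edge \<Rightarrow> 'd cell \<Rightarrow> real" where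
  "mass_flux \<Omega> M r v Q \<sigma> K =
     (if \<sigma> \<in> int_edges \<Omega> M
      then area \<sigma> * (edge_density \<Omega> M r \<sigma> * normal_value v \<sigma> K - normal_value Q \<sigma> K)
      else 0)"

definition mass_balance ::
  "'d::finite cell set \<Rightarrow> real \<Rightarrow> ('d cell \<Rightarrow> real) \<Rightarrow> ('d cell \<Rightarrow> real) \<Rightarrow>
   ('d edge \<Rightarrow> 'd cell \<Rightarrow> real) \<Rightarrow> bool" where
  "mass_balance M dt r r' F \<longleftrightarrow>
     (\<forall>K\<in>M. 1 / dt * (r' K - r K) + 1 / vol K * (\<Sum>\<sigma>\<in>cell_edges K. F \<sigma> K) = 0)"

text \<open>
  The dual flux \<open>F\<^sub>\<epsilon>\<^sub>,\<^sub>\<sigma>\<close>, outward to \<open>D\<^sub>\<sigma>\<close>, as the linear combination with coefficients \<open>c\<close> of the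
  primal fluxes at the neighbouring edges, taken to be the edges of the cells that meet \<open>D\<^sub>\<sigma>\<close>.
\<close>

definition dual_flux ::
  "(real ^ 'd::finite) set \<Rightarrow> 'd cell set \<Rightarrow>
   ('d edge \<Rightarrow> 'd edge \<Rightarrow> 'd edge \<Rightarrow> 'd cell \<Rightarrow> real) \<Rightarrow>
   ('d edge \<Rightarrow> 'd cell \<Rightarrow> real) \<Rightarrow> 'd edge \<Rightarrow> 'd edge \<Rightarrow> real" where
  "dual_flux \<Omega> M c F \<epsilon> \<sigma> =
     (if \<epsilon> \<subseteq> frontier \<Omega> then 0
      else \<Sum>K\<in>{K \<in> M. K \<inter> dual_cell M \<sigma> \<noteq> {}}. \<Sum>\<tau>\<in>cell_edges K. c \<epsilon> \<sigma> \<tau> K * F \<tau> K)"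

definition dual_mass_balance ::
  "(real ^ 'd::finite) set \<Rightarrow> 'd cell set \<Rightarrow> real \<Rightarrow> ('d cell \<Rightarrow> real) \<Rightarrow> ('d cell \<Rightarrow> real) \<Rightarrow>
   ('d edge \<Rightarrow> 'd edge \<Rightarrow> real) \<Rightarrow> bool" where
  "dual_mass_balance \<Omega> M dt r r' G \<longleftrightarrow>
     (\<forall>\<sigma>\<in>int_edges \<Omega> M.
        1 / dt * (dual_average \<Omega> M r' \<sigma> - dual_average \<Omega> M r \<sigma>) +
        1 / vol (dual_cell M \<sigma>) * (\<Sum>\<epsilon>\<in>cell_edges (dual_cell M \<sigma>). G \<epsilon> \<sigma>) = 0)"

definition conservative_flux ::
  "(real ^ 'd::finite) set \<Rightarrow> 'd cell set \<Rightarrow> ('d edge \<Rightarrow> 'd cell \<Rightarrow> real) \<Rightarrow> bool" where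
  "conservative_flux \<Omega> M F \<longleftrightarrow>
     (\<forall>\<sigma> K L. edge_between \<Omega> M \<sigma> K L \<longrightarrow> F \<sigma> K = - F \<sigma> L) \<and>
     (\<forall>\<sigma>\<in>ext_edges \<Omega> M. \<forall>K\<in>M. F \<sigma> K = 0)"

text \<open>
  The requirements on the coefficients: for any conservative primal flux, the dual flux takes opposite
  values from the two sides of an edge separating two internal dual cells, and the primal mass balance
  implies the dual one.  Every choice of coefficients with these properties is allowed.  The usual MAC
  choice is \<open>(F\<^sub>\<sigma>\<^sub>'\<^sub>,\<^sub>K - F\<^sub>\<sigma>\<^sub>,\<^sub>K) / 2\<close> if \<open>\<epsilon>\<close> lies in \<open>K\<close> between \<open>\<sigma>\<close> and the opposite face \<open>\<sigma>'\<close>, and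
  \<open>(F\<^sub>\<tau>\<^sub>,\<^sub>K + F\<^sub>\<tau>\<^sub>'\<^sub>,\<^sub>L) / 2\<close> if \<open>\<epsilon>\<close> is made of halves of faces \<open>\<tau>\<close> of \<open>K\<close> and \<open>\<tau>'\<close> of \<open>L\<close>.
\<close>

definition dual_flux_coeffs ::
  "(real ^ 'd::finite) set \<Rightarrow> 'd cell set \<Rightarrow>
   ('d edge \<Rightarrow> 'd edge \<Rightarrow> 'd edge \<Rightarrow> 'd cell \<Rightarrow> real) \<Rightarrow> bool" where
  "dual_flux_coeffs \<Omega> M c \<longleftrightarrow>
     (\<forall>F. conservative_flux \<Omega> M F \<longrightarrow>
        (\<forall>\<epsilon> \<sigma> \<sigma>'. \<sigma> \<in> int_edges \<Omega> M \<and> \<sigma>' \<in> int_edges \<Omega> M \<and> dual_edge_between M \<epsilon> \<sigma> \<sigma>' \<longrightarrow>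
           dual_flux \<Omega> M c F \<epsilon> \<sigma> = - dual_flux \<Omega> M c F \<epsilon> \<sigma>') \<and>
        (\<forall>dt r r'. dt > 0 \<and> mass_balance M dt r r' F \<longrightarrow>
           dual_mass_balance \<Omega> M dt r r' (dual_flux \<Omega> M c F)))"

text \<open>If \<open>\<epsilon> \<subseteq> frontier \<Omega>\<close> there is no \<open>\<sigma>'\<close>, but then the dual flux \<open>G \<epsilon> \<sigma>\<close> is \<open>0\<close>.\<close>

definition upwind ::
  "'d::finite cell set \<Rightarrow> ('d edge \<Rightarrow> 'd edge \<Rightarrow> real) \<Rightarrow> ('d edge \<Rightarrow> real) \<Rightarrow>
   'd edge \<Rightarrow> 'd edge \<Rightarrow> real" where
  "upwind M G v \<epsilon> \<sigma> = (if G \<epsilon> \<sigma> \<ge> 0 then v \<sigma> else v (THE \<sigma>'. dual_edge_between M \<epsilon> \<sigma> \<sigma>'))"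


section \<open>The scheme\<close>

definition momentum_balance ::
  "(real ^ 'd::finite) set \<Rightarrow> 'd cell set \<Rightarrow> real \<Rightarrow> ('d cell \<Rightarrow> real) \<Rightarrow> ('d cell \<Rightarrow> real) \<Rightarrow>
   ('d edge \<Rightarrow> real) \<Rightarrow> ('d edge \<Rightarrow> real) \<Rightarrow> ('d cell \<Rightarrow> real) \<Rightarrow> ('d cell \<Rightarrow> real) \<Rightarrow>
   ('d edge \<Rightarrow> 'd edge \<Rightarrow> real) \<Rightarrow> bool" where
  "momentum_balance \<Omega> M dt r r' v v' p' Lam G \<longleftrightarrow>
     (\<forall>i. \<forall>\<sigma>\<in>int_edges_dir \<Omega> M i.
        1 / dt * (dual_average \<Omega> M r' \<sigma> * v' \<sigma> - dual_average \<Omega> M r \<sigma> * v \<sigma>) +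
        1 / vol (dual_cell M \<sigma>) *
          (\<Sum>\<epsilon>\<in>cell_edges (dual_cell M \<sigma>). G \<epsilon> \<sigma> * upwind M G v \<epsilon> \<sigma>) =
        - edge_density \<Omega> M r \<sigma> * edge_deriv \<Omega> M p' \<sigma> + edge_deriv \<Omega> M Lam \<sigma>)"

definition poisson_boltzmann ::
  "(real ^ 'd::finite) set \<Rightarrow> 'd cell set \<Rightarrow> real \<Rightarrow> ('d cell \<Rightarrow> real) \<Rightarrow> ('d cell \<Rightarrow> real) \<Rightarrow> bool"
  where
  "poisson_boltzmann \<Omega> M eps r p \<longleftrightarrow>
     (\<forall>K\<in>M. - (eps^2) * cell_laplacian \<Omega> M p K = r K - exp (p K))"

text \<open>
  In the sequences \<open>rho\<close>, \<open>u\<close>, \<open>phi\<close>, \<open>Q\<close>, \<open>Lam\<close> the first argument is the time level.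
\<close>

definition scheme_solution ::
  "(real ^ 'd::finite) set \<Rightarrow> 'd cell set \<Rightarrow>
   ('d edge \<Rightarrow> 'd edge \<Rightarrow> 'd edge \<Rightarrow> 'd cell \<Rightarrow> real) \<Rightarrow> real \<Rightarrow> nat \<Rightarrow> real \<Rightarrow>
   (nat \<Rightarrow> 'd cell \<Rightarrow> real) \<Rightarrow> (nat \<Rightarrow> 'd edge \<Rightarrow> real) \<Rightarrow> (nat \<Rightarrow> 'd cell \<Rightarrow> real) \<Rightarrow>
   (nat \<Rightarrow> 'd edge \<Rightarrow> real) \<Rightarrow> (nat \<Rightarrow> 'd cell \<Rightarrow> real) \<Rightarrow> bool" where
  "scheme_solution \<Omega> M c dt N eps rho u phi Q Lam \<longleftrightarrow>
     (\<forall>n\<le>N. (\<forall>K\<in>M. rho n K > 0) \<and> vanishes_ext \<Omega> M (u n)) \<and>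
     (\<forall>n<N. vanishes_ext \<Omega> M (Q (Suc n))) \<and>
     (\<forall>n<N.
        let F = mass_flux \<Omega> M (rho n) (u n) (Q (Suc n));
            G = dual_flux \<Omega> M c F
        in mass_balance M dt (rho n) (rho (Suc n)) F \<and>
           momentum_balance \<Omega> M dt (rho n) (rho (Suc n)) (u n) (u (Suc n)) (phi (Suc n)) (Lam n) G \<and>
           poisson_boltzmann \<Omega> M eps (rho (Suc n)) (phi (Suc n)))"

definition initialised ::
  "(real ^ 'd::finite) set \<Rightarrow> 'd cell set \<Rightarrow>
   (real ^ 'd \<Rightarrow> real) \<Rightarrow> (real ^ 'd \<Rightarrow> real ^ 'd) \<Rightarrow> (real ^ 'd \<Rightarrow> real) \<Rightarrow>
   ('d cell \<Rightarrow> real) \<Rightarrow> ('d edge \<Rightarrow> real) \<Rightarrow> ('d cell \<Rightarrow> real) \<Rightarrow> bool" where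
  "initialised \<Omega> M rho0 u0 phi0 r v p \<longleftrightarrow>
     (\<forall>K\<in>M. r K = 1 / vol K * (LINT x:K|lebesgue. rho0 x)) \<and>
     (\<forall>K\<in>M. p K = 1 / vol K * (LINT x:K|lebesgue. phi0 x)) \<and>
     (\<forall>i. \<forall>\<sigma>\<in>int_edges_dir \<Omega> M i.
        v \<sigma> = 1 / vol (dual_cell M \<sigma>) * (LINT x:dual_cell M \<sigma>|lebesgue. u0 x $ i))"


section \<open>Time-step restriction\<close>

definition neg_part :: "real \<Rightarrow> real" where
  "neg_part a = (a - \<bar>a\<bar>) / 2"

definition alpha ::
  "(real ^ 'd::finite) set \<Rightarrow> 'd cell set \<Rightarrow> ('d cell \<Rightarrow> real) \<Rightarrow> 'd cell \<Rightarrow> 'd edge \<Rightarrow> real" where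
  "alpha \<Omega> M r' K \<sigma> =
     perimeter K / vol K * (area \<sigma> / vol (dual_cell M \<sigma>)) * (1 / dual_average \<Omega> M r' \<sigma>)"

text \<open>
  The first bound is \<open>+\<infinity>\<close>, that is, void, if its denominator vanishes; this case is separated because
  of the convention \<open>x / 0 = 0\<close>.
\<close>

definition cfl_condition ::
  "(real ^ 'd::finite) set \<Rightarrow> 'd cell set \<Rightarrow> real \<Rightarrow> ('d cell \<Rightarrow> real) \<Rightarrow>
   ('d edge \<Rightarrow> 'd edge \<Rightarrow> real) \<Rightarrow> bool" where
  "cfl_condition \<Omega> M dt r' G \<longleftrightarrow>
     (\<forall>K\<in>M. \<forall>\<sigma>\<in>cell_edges K \<inter> int_edges \<Omega> M.
        (let S = (\<Sum>\<epsilon>\<in>cell_edges (dual_cell M \<sigma>). - neg_part (G \<epsilon> \<sigma>))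
         in S \<noteq> 0 \<longrightarrow> dt \<le> dual_average \<Omega> M r' \<sigma> * vol (dual_cell M \<sigma>) / (4 * S)) \<and>
        dt \<le> 1 / 2 * sqrt (1 / alpha \<Omega> M r' K \<sigma>))"

end

theory Submission
  imports Defs
begin

text \<open>
  Test the momentum balance with \<open>|D\<^sub>\<sigma>| u\<^sup>n\<^sub>\<sigma>\<close> and use the dual mass balance.  With \<open>v = u\<^sup>n\<^sub>\<sigma>\<close> and
  \<open>v' = u\<^sup>n\<^sup>+\<^sup>1\<^sub>\<sigma>\<close>, the kinetic energy increment is the sum of the energy flux
  \<open>- 1/2 \<Sum>\<^sub>\<epsilon> F\<^sub>\<epsilon>\<^sub>,\<^sub>\<sigma> u\<^sub>\<epsilon>\<^sub>,\<^sub>u\<^sub>p\<^sup>2\<close>, the work of the electric force and of \<open>\<Lambda>\<close>, the upwind dissipation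
  \<open>- 1/2 \<Sum>\<^sub>\<epsilon> |F\<^sup>-\<^sub>\<epsilon>\<^sub>,\<^sub>\<sigma>| (v - u\<^sub>\<epsilon>\<^sub>,\<^sub>u\<^sub>p)\<^sup>2\<close>, and the positive explicit-time error
  \<open>|D\<^sub>\<sigma>| / (2 \<delta>t) \<rho>\<^sup>n\<^sup>+\<^sup>1\<^sub>D (v' - v)\<^sup>2\<close>.  By the momentum balance again, \<open>\<rho>\<^sup>n\<^sup>+\<^sup>1\<^sub>D (v' - v) / \<delta>t\<close> is a sum
  \<open>A + B + C\<close> of an upwind difference, the force \<open>- \<rho>\<^sub>\<sigma> \<partial>\<phi>\<close>, and \<open>\<partial>\<Lambda>\<close>.  The weights in
  \<open>(A + B + C)\<^sup>2 \<le> 4 A\<^sup>2 + 2 B\<^sup>2 + 4 C\<^sup>2\<close>, admissible since \<open>1/4 + 1/2 + 1/4 = 1\<close>, are those for which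
  each of the three terms is exactly compensated: the first by the upwind dissipation (first part of
  the CFL condition), the second by the dissipation \<open>- \<eta> \<delta>t |D\<^sub>\<sigma>| |\<partial>\<phi>|\<^sup>2\<close> which \<open>Q\<close> creates in
  the mass balance, the third by the dissipation \<open>- |K| \<Lambda>\<^sub>K\<^sup>2 / \<delta>t\<close> which \<open>\<Lambda>\<close> creates in the momentum
  balance (second part of the CFL condition).  The first two are in \<open>edge_kinetic_estimate\<close>, the
  third is \<open>stabilisation_absorbed\<close>.

  The electric work is turned into a potential energy decrement by the duality of discrete divergence
  and gradient, the mass balance tested with \<open>\<phi>\<^sup>n\<^sup>+\<^sup>1\<close>, the Poisson equation at both time levels, and
  the convexity of the exponential (\<open>potential_energy_estimate\<close>).

  What remains is that the kinetic energy fluxes \<open>F\<^sub>\<epsilon>\<^sub>,\<^sub>\<sigma> u\<^sub>\<epsilon>\<^sub>,\<^sub>u\<^sub>p\<^sup>2\<close> have a nonnegative sum over all faces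
  of all internal dual cells (\<open>upwind_energy_flux_nonneg\<close>): they cancel in pairs across faces
  between two internal dual cells, and what enters from an external edge is zero since the velocity
  vanishes there.  This rests on the geometry of the grid:
  a face of a dual cell that is not in the boundary of \<open>\<Omega>\<close> has exactly one neighbour, and the
  relation of being neighbours is symmetric between internal edges.  The idea there is to describe
  boxes by their extents in the coordinate directions, so that disjointness, contact and conformity
  become statements about intervals.
\<close>

section \<open>Boxes and their faces\<close>


abbreviation lo :: "(real ^ 'd::finite) set \<Rightarrow> real ^ 'd" where "lo \<equiv> interval_lowerbound"
abbreviation hi :: "(real ^ 'd::finite) set \<Rightarrow> real ^ 'd" where "hi \<equiv> interval_upperbound"

text \<open>
  The Boolean \<open>b\<close> stands for the orientation of a face (upper if \<open>True\<close>), so that mirror images need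
  not be treated separately: the opposite face is obtained from \<open>\<not> b\<close>.
\<close>

definition side :: "bool \<Rightarrow> (real ^ 'd::finite) set \<Rightarrow> real ^ 'd" where
  "side b A = (if b then hi A else lo A)"

definition face :: "bool \<Rightarrow> 'd::finite \<Rightarrow> (real ^ 'd) set \<Rightarrow> (real ^ 'd) set" where
  "face b i A = (if b then upper_face i A else lower_face i A)"

definition mid :: "'d::finite \<Rightarrow> (real ^ 'd) set \<Rightarrow> real" where
  "mid i A = (lo A $ i + hi A $ i) / 2"

definition solid_box :: "(real ^ 'd::finite) set \<Rightarrow> bool" where
  "solid_box A \<longleftrightarrow> A = cbox (lo A) (hi A) \<and> (\<forall>k. lo A $ k < hi A $ k)"

text \<open>Overlap of the open intervals; contact in a common end point does not count.\<close>

definition overlap :: "'d::finite \<Rightarrow> (real ^ 'd) set \<Rightarrow> (real ^ 'd) set \<Rightarrow> bool" where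
  "overlap k A B \<longleftrightarrow> lo A $ k < hi B $ k \<and> lo B $ k < hi A $ k"

definition set_coord :: "real ^ 'd::finite \<Rightarrow> 'd \<Rightarrow> real \<Rightarrow> real ^ 'd" where
  "set_coord a i s = (\<chi> k. if k = i then s else a $ k)"

lemma set_coord_nth [simp]: "set_coord a i s $ k = (if k = i then s else a $ k)"
  by (simp add: set_coord_def)

lemma bounds_cbox_cart:
  fixes a b :: "real ^ 'd::finite"
  assumes "\<And>k. a $ k \<le> b $ k"
  shows "lo (cbox a b) = a" "hi (cbox a b) = b"
  using assms by (auto simp: Basis_vec_def inner_axis intro!: interval_lowerbound interval_upperbound)

lemma solid_box_cbox:
  fixes a b :: "real ^ 'd::finite"
  assumes "\<And>k. a $ k < b $ k"
  shows "solid_box (cbox a b)"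
  using assms by (simp add: solid_box_def bounds_cbox_cart less_imp_le)

lemma solid_boxD:
  assumes "solid_box A"
  shows "A = cbox (lo A) (hi A)" "lo A $ k < hi A $ k"
  using assms by (auto simp: solid_box_def)

lemma solid_box_mem: "solid_box A \<Longrightarrow> x \<in> A \<longleftrightarrow> (\<forall>k. lo A $ k \<le> x $ k \<and> x $ k \<le> hi A $ k)"
  by (metis solid_boxD(1) mem_box_cart(2))

lemma solid_box_side_less: "solid_box A \<Longrightarrow> side False A $ k < side True A $ k"
  by (simp add: side_def solid_boxD)


lemma solid_box_mid: "solid_box A \<Longrightarrow> lo A $ i < mid i A \<and> mid i A < hi A $ i"
  using solid_boxD(2)[of A i] by (simp add: mid_def)

lemma face_mem: "x \<in> face b i A \<longleftrightarrow> x \<in> A \<and> x $ i = side b A $ i"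
  by (auto simp: face_def side_def upper_face_def lower_face_def)

lemma face_eq_cbox:
  assumes A: "solid_box A"
  shows "face b i A = cbox (set_coord (lo A) i (side b A $ i)) (set_coord (hi A) i (side b A $ i))"
proof -
  have "lo A $ i \<le> side b A $ i" "side b A $ i \<le> hi A $ i"
    using solid_boxD(2)[OF A, of i] by (auto simp: side_def)
  then have "(lo A $ k \<le> x $ k \<and> x $ k \<le> hi A $ k) \<and> (k = i \<longrightarrow> x $ k = side b A $ i) \<longleftrightarrow>
      set_coord (lo A) i (side b A $ i) $ k \<le> x $ k \<and> x $ k \<le> set_coord (hi A) i (side b A $ i) $ k"
    for x k by auto
  then show ?thesis
    unfolding set_eq_iff face_mem solid_box_mem[OF A] mem_box_cart by blast
qed

lemma face_bounds:
  assumes A: "solid_box A"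
  shows "lo (face b i A) $ k = (if k = i then side b A $ i else lo A $ k)"
    "hi (face b i A) $ k = (if k = i then side b A $ i else hi A $ k)"
  unfolding face_eq_cbox[OF A]
  by (subst bounds_cbox_cart; auto simp: solid_boxD(2)[OF A] less_imp_le)+

lemma edge_dir_face [simp]:
  assumes A: "solid_box A"
  shows "edge_dir (face b i A) = i"
  unfolding edge_dir_def
proof (rule the_equality)
  show "k = i" if "lo (face b i A) $ k = hi (face b i A) $ k" for k
    using that solid_boxD(2)[OF A, of k] by (auto simp: face_bounds[OF A] split: if_splits)
qed (simp add: face_bounds[OF A])

text \<open>
  Edges are sets of points, but a face determines its direction (the only one in which it is flat),
  its position and its transversal extents, and nothing more.  It is through this equivalence that
  coincidence of faces of two cells is translated into equality of their transversal extents.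
\<close>

lemma face_eq_iff:
  assumes A: "solid_box A" and B: "solid_box B"
  shows "face b i A = face b' i' B \<longleftrightarrow> i = i' \<and> side b A $ i = side b' B $ i \<and>
    (\<forall>k. k \<noteq> i \<longrightarrow> lo A $ k = lo B $ k \<and> hi A $ k = hi B $ k)"
proof
  assume e: "face b i A = face b' i' B"
  then have i: "i = i'"
    by (metis edge_dir_face A B)
  have "\<And>k. lo (face b i A) $ k = lo (face b' i' B) $ k" "\<And>k. hi (face b i A) $ k = hi (face b' i' B) $ k"
    using e by auto
  with i show "i = i' \<and> side b A $ i = side b' B $ i \<and>
    (\<forall>k. k \<noteq> i \<longrightarrow> lo A $ k = lo B $ k \<and> hi A $ k = hi B $ k)"
    unfolding face_bounds[OF A] face_bounds[OF B] by (metis (full_types))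
next
  assume "i = i' \<and> side b A $ i = side b' B $ i \<and>
    (\<forall>k. k \<noteq> i \<longrightarrow> lo A $ k = lo B $ k \<and> hi A $ k = hi B $ k)"
  then show "face b i A = face b' i' B"
    unfolding face_eq_cbox[OF A] face_eq_cbox[OF B]
    by (intro arg_cong2[where f = cbox]) (auto simp: vec_eq_iff)
qed

lemma cell_edges_dir_faces: "cell_edges_dir i A = {face b i A | b. True}"
  by (auto simp: cell_edges_dir_def face_def)

lemma cell_edges_faces: "cell_edges A = {face b i A | b i. True}"
  by (auto simp: cell_edges_def cell_edges_dir_faces)

lemma finite_cell_edges [simp]: "finite (cell_edges A)"
  by (simp add: cell_edges_def cell_edges_dir_def)

lemma cell_edges_nonempty: "cell_edges A \<noteq> {}"
  by (auto simp: cell_edges_faces)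

lemma face_upper_iff:
  assumes A: "solid_box A"
  shows "face b i A = upper_face i A \<longleftrightarrow> b"
  using face_eq_iff[OF A A, of b i True i] solid_box_side_less[OF A, of i]
  by (cases b) (auto simp: face_def)

lemma half_cell_face:
  assumes A: "solid_box A"
  shows "half_cell (face b i A) A =
    (if b then cbox (set_coord (lo A) i (mid i A)) (hi A) else cbox (lo A) (set_coord (hi A) i (mid i A)))"
  using solid_box_mid[OF A, of i]
  by (auto simp: half_cell_def Let_def A face_upper_iff[OF A] solid_box_mem[OF A] mem_box_cart
      mid_def[symmetric] split: if_splits) (metis less_imp_le order_trans)+

lemma outer_normal_face:
  assumes A: "solid_box A"
  shows "outer_normal (face b i A) A = (if b then axis i 1 else - axis i 1)"
  by (simp add: outer_normal_def A face_upper_iff)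


lemma solid_box_vol_pos: "solid_box A \<Longrightarrow> vol A > 0"
proof -
  assume A: "solid_box A"
  have "vol (cbox (lo A) (hi A)) > 0"
    using solid_boxD(2)[OF A] by (auto simp: Basis_vec_def inner_axis intro!: content_pos_lt)
  then show "vol A > 0"
    using solid_boxD(1)[OF A] by simp
qed

lemma solid_box_area_pos:
  assumes A: "solid_box A"
  shows "area (face b i A) > 0"
  unfolding area_def by (rule prod_pos) (auto simp: A face_bounds solid_boxD(2))

subsection \<open>Codimension one contact\<close>

text \<open>A box that is flat only in direction \<open>j\<close> contains a nonempty, relatively open part of a hyperplane.\<close>

lemma aff_dim_box_in_hyperplane:
  fixes p q :: "real ^ 'd::finite"
  assumes "p $ j = q $ j" "\<And>k. k \<noteq> j \<Longrightarrow> p $ k < q $ k"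
  shows "aff_dim (cbox p q) = int CARD('d) - 1"
proof -
  let ?H = "{x :: real^'d. axis j 1 \<bullet> x = p $ j}"
  let ?p = "set_coord p j (p $ j - 1)" and ?q = "set_coord q j (p $ j + 1)"
  have H: "aff_dim ?H = int CARD('d) - 1"
    by (subst aff_dim_hyperplane) auto
  have sub: "box ?p ?q \<inter> ?H \<subseteq> cbox p q"
  proof
    fix x assume x: "x \<in> box ?p ?q \<inter> ?H"
    then have b: "?p $ k < x $ k \<and> x $ k < ?q $ k" for k
      by (meson IntD1 mem_box_cart(1))
    have "x $ j = p $ j"
      using x by (simp add: inner_axis')
    then have "p $ k \<le> x $ k \<and> x $ k \<le> q $ k" for k
      using b[of k] assms(1) by (cases "k = j") auto
    then show "x \<in> cbox p q"
      by (simp add: mem_box_cart)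
  qed
  have "openin (top_of_set ?H) (?H \<inter> box ?p ?q)"
    by (intro openin_open_Int open_box)
  moreover have "(\<chi> k. (p $ k + q $ k) / 2) \<in> ?H \<inter> box ?p ?q"
    using assms by (auto simp: mem_box_cart inner_axis')
  ultimately have "aff_dim (?H \<inter> box ?p ?q) = aff_dim ?H"
    by (intro aff_dim_openin affine_hyperplane) auto
  then have "aff_dim (cbox p q) \<ge> int CARD('d) - 1"
    using aff_dim_subset[OF sub] H by (simp add: Int_commute)
  moreover have "cbox p q \<subseteq> ?H"
    using assms by (auto simp: mem_box_cart inner_axis' order_antisym) (metis order_antisym)
  then have "aff_dim (cbox p q) \<le> int CARD('d) - 1"
    using aff_dim_subset H by metis
  ultimately show ?thesis by simp
qed

lemma aff_dim_two_hyperplanes: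
  fixes S :: "(real ^ 'd::finite) set"
  assumes "j \<noteq> k" "\<And>x. x \<in> S \<Longrightarrow> x $ j = s \<and> x $ k = t"
  shows "aff_dim S < int CARD('d) - 1"
proof -
  let ?H = "{x :: real^'d. axis j 1 \<bullet> x = s}" and ?I = "{x :: real^'d. axis k 1 \<bullet> x = t}"
  have H: "aff_dim ?H = int CARD('d) - 1"
    by (subst aff_dim_hyperplane) auto
  have "set_coord (vec s) k (t + 1) \<in> ?H - ?I"
    using assms(1) by (auto simp: inner_axis')
  moreover have "set_coord (vec s) k t \<in> ?H \<inter> ?I"
    using assms(1) by (auto simp: inner_axis')
  ultimately have "aff_dim (?H \<inter> ?I) = aff_dim ?H - 1"
    by (subst aff_dim_affine_Int_hyperplane) (auto intro: affine_hyperplane)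
  moreover have "S \<subseteq> ?H \<inter> ?I"
    using assms(2) by (auto simp: inner_axis')
  ultimately show ?thesis
    using H aff_dim_subset[of S "?H \<inter> ?I"] by linarith
qed

text \<open>
  This replaces the dimension condition in the definition of neighbouring dual cells by interval
  conditions: if the intervals fail to overlap in a direction \<open>k\<close>, the intersection is also contained
  in a hyperplane orthogonal to the \<open>k\<close>-th axis.
\<close>

lemma aff_dim_face_Int_box:
  fixes A B :: "(real ^ 'd::finite) set"
  assumes A: "solid_box A" and B: "solid_box B"
  shows "aff_dim (face b j A \<inter> B) = int CARD('d) - 1 \<longleftrightarrow>
    lo B $ j \<le> side b A $ j \<and> side b A $ j \<le> hi B $ j \<and> (\<forall>k. k \<noteq> j \<longrightarrow> overlap k A B)"
    (is "?L \<longleftrightarrow> ?R")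
proof
  assume L: ?L
  then have "face b j A \<inter> B \<noteq> {}"
    by (auto simp: aff_dim_empty_eq)
  then obtain x where x: "x \<in> A" "x $ j = side b A $ j" "x \<in> B"
    by (auto simp: face_mem)
  have "overlap k A B" if k: "k \<noteq> j" for k
  proof (rule ccontr)
    assume n: "\<not> overlap k A B"
    have "y $ k = x $ k" if "y \<in> A" "y \<in> B" for y
    proof -
      have "lo A $ k \<le> y $ k" "lo B $ k \<le> y $ k" "y $ k \<le> hi A $ k" "y $ k \<le> hi B $ k"
        "lo A $ k \<le> x $ k" "lo B $ k \<le> x $ k" "x $ k \<le> hi A $ k" "x $ k \<le> hi B $ k"
        using that x by (auto simp: solid_box_mem A B)
      with n show ?thesis unfolding overlap_def by linarith
    qed
    then have "aff_dim (face b j A \<inter> B) < int CARD('d) - 1"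
      using k by (intro aff_dim_two_hyperplanes[of j k _ "side b A $ j" "x $ k"]) (auto simp: face_mem)
    with L show False by simp
  qed
  with x show ?R by (metis solid_box_mem B)
next
  assume R: ?R
  let ?s = "side b A $ j"
  let ?p = "\<chi> k. if k = j then ?s else max (lo A $ k) (lo B $ k)"
  let ?q = "\<chi> k. if k = j then ?s else min (hi A $ k) (hi B $ k)"
  have s: "lo A $ j \<le> ?s" "?s \<le> hi A $ j"
    using solid_boxD(2)[OF A, of j] by (auto simp: side_def)
  have "x \<in> face b j A \<inter> B \<longleftrightarrow> x \<in> cbox ?p ?q" for x
  proof -
    have "x \<in> cbox ?p ?q \<longleftrightarrow> (\<forall>k. ?p $ k \<le> x $ k \<and> x $ k \<le> ?q $ k)"
      by (rule mem_box_cart)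
    also have "\<dots> \<longleftrightarrow> x $ j = ?s \<and> (\<forall>k. lo A $ k \<le> x $ k \<and> x $ k \<le> hi A $ k \<and> lo B $ k \<le> x $ k \<and> x $ k \<le> hi B $ k)"
      (is "_ \<longleftrightarrow> ?Q")
    proof
      assume l: "\<forall>k. ?p $ k \<le> x $ k \<and> x $ k \<le> ?q $ k"
      have "x $ j = ?s" using l[rule_format, of j] by simp
      moreover have "lo A $ k \<le> x $ k \<and> x $ k \<le> hi A $ k \<and> lo B $ k \<le> x $ k \<and> x $ k \<le> hi B $ k" for k
        using l[rule_format, of k] s R \<open>x $ j = ?s\<close> by (cases "k = j") auto
      ultimately show ?Q by blast
    next
      assume ?Q
      then show "\<forall>k. ?p $ k \<le> x $ k \<and> x $ k \<le> ?q $ k" by auto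
    qed
    finally show ?thesis
      by (auto simp: face_mem solid_box_mem A B)
  qed
  then have "face b j A \<inter> B = cbox ?p ?q" by blast
  moreover have "aff_dim (cbox ?p ?q) = int CARD('d) - 1"
    using R by (intro aff_dim_box_in_hyperplane[of _ j])
      (auto simp: overlap_def solid_boxD(2)[OF A] solid_boxD(2)[OF B])
  ultimately show ?L by simp
qed


section \<open>Conformity of the grid\<close>

locale conforming_grid =
  fixes \<Omega> :: "(real ^ 'd::finite) set" and M :: "'d cell set"
  assumes grid: "mac_grid \<Omega> M"
begin

lemma division: "M division_of closure \<Omega>"
  using grid by (simp add: mac_grid_def)

lemma finite_cells [simp]: "finite M"
  using division by (rule division_of_finite)

lemma cell_solid:
  assumes "K \<in> M"
  shows "solid_box K"
proof -
  obtain a b where K: "K = cbox a b"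
    using division_ofD(4)[OF division assms] by blast
  then have "box a b \<noteq> {}"
    using grid assms by (auto simp: mac_grid_def)
  then have "a $ k < b $ k" for k
    using interval_eq_empty_cart(1)[of a b] by (meson not_le)
  then show ?thesis
    using K solid_box_cbox by blast
qed

lemma cells_eqI:
  assumes K: "K \<in> M" and L: "L \<in> M" and ov: "\<And>k. overlap k K L"
  shows "K = L"
proof (rule ccontr)
  assume "K \<noteq> L"
  then have "interior K \<inter> interior L = {}"
    using division_ofD(5)[OF division K L] by blast
  moreover have "interior A = box (lo A) (hi A)" if "A \<in> M" for A
    using arg_cong[OF solid_boxD(1)[OF cell_solid[OF that]], of interior] by (simp only: interior_cbox)
  moreover have "\<exists>x. x \<in> box (lo K) (hi K) \<inter> box (lo L) (hi L)"
  proof -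
    have m: "max (lo K $ k) (lo L $ k) < min (hi K $ k) (hi L $ k)" for k
      using ov[of k] solid_boxD(2)[OF cell_solid[OF K], of k] solid_boxD(2)[OF cell_solid[OF L], of k]
      by (auto simp: overlap_def)
    have "\<exists>z. \<forall>k. max (lo K $ k) (lo L $ k) < z k \<and> z k < min (hi K $ k) (hi L $ k)"
      by (rule choice) (intro allI dense m)
    then obtain z where "\<And>k. max (lo K $ k) (lo L $ k) < z k \<and> z k < min (hi K $ k) (hi L $ k)"
      by blast
    then have "(\<chi> k. z k) \<in> box (lo K) (hi K) \<inter> box (lo L) (hi L)"
      by (simp add: mem_box_cart)
    then show ?thesis ..
  qed
  ultimately show False
    using K L by auto
qed

lemma cell_of_face_unique:
  assumes K: "K \<in> M" and L: "L \<in> M" and e: "face b i K = face b i L"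
  shows "K = L"
proof (rule cells_eqI[OF K L])
  note s = cell_solid[OF K] cell_solid[OF L]
  fix k
  have "k \<noteq> i \<Longrightarrow> lo K $ k = lo L $ k \<and> hi K $ k = hi L $ k" "side b K $ i = side b L $ i"
    using e face_eq_iff[OF s] by auto
  then show "overlap k K L"
    using solid_boxD(2)[OF s(1), of k] solid_boxD(2)[OF s(2), of k]
    by (cases "k = i"; cases b) (auto simp: overlap_def side_def)
qed

lemma face_direction_unique:
  assumes "K \<in> M" "L \<in> M" "face b i K = face b' j L"
  shows "i = j"
  using assms face_eq_iff[OF cell_solid cell_solid] by blast

text \<open>
  Near a point in the relative interior of the contact set, the two cells fill a whole neighbourhood,
  which lies in \<open>interior (closure \<Omega>) = \<Omega>\<close>.  Hence a face that is touched from the other side, even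
  only on a part of it, is internal.
\<close>

lemma touching_face_not_in_frontier:
  assumes K: "K \<in> M" and P: "P \<in> M" and s: "hi K $ j = lo P $ j"
    and ov: "\<And>k. k \<noteq> j \<Longrightarrow> overlap k K P"
  shows "\<not> face True j K \<subseteq> frontier \<Omega>"
proof
  assume f: "face True j K \<subseteq> frontier \<Omega>"
  note sK = cell_solid[OF K] and sP = cell_solid[OF P]
  let ?p = "\<chi> k. if k = j then lo K $ j else max (lo K $ k) (lo P $ k)"
  let ?q = "\<chi> k. if k = j then hi P $ j else min (hi K $ k) (hi P $ k)"
  let ?x = "\<chi> k. if k = j then hi K $ j else (?p $ k + ?q $ k) / 2"
  have pq: "?p $ k < ?q $ k" if "k \<noteq> j" for k
    using that ov[OF that] solid_boxD(2)[OF sK, of k] solid_boxD(2)[OF sP, of k]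
    by (auto simp: overlap_def)
  have "?x \<in> face True j K"
  proof -
    have "lo K $ k \<le> ?x $ k \<and> ?x $ k \<le> hi K $ k" for k
      using pq[of k] solid_boxD(2)[OF sK, of k] by (auto simp: max_def min_def split: if_splits)
    then show ?thesis
      by (simp add: face_mem solid_box_mem[OF sK] side_def)
  qed
  moreover have "?x \<in> interior \<Omega>"
  proof -
    have "?p $ k < ?x $ k \<and> ?x $ k < ?q $ k" for k
      using pq[of k] s solid_boxD(2)[OF sK, of j] solid_boxD(2)[OF sP, of j] by auto
    then have x: "?x \<in> box ?p ?q"
      by (simp only: mem_box_cart simp_thms)
    have "box ?p ?q \<subseteq> K \<union> P"
    proof
      fix y assume y: "y \<in> box ?p ?q"
      have b: "?p $ k < y $ k \<and> y $ k < ?q $ k" for k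
        using y by (simp only: mem_box_cart simp_thms)
      show "y \<in> K \<union> P"
      proof (cases "y $ j \<le> hi K $ j")
        case True
        then have "lo K $ k \<le> y $ k \<and> y $ k \<le> hi K $ k" for k
          using b[of k] by (cases "k = j") auto
        then show ?thesis by (simp add: solid_box_mem[OF sK])
      next
        case False
        then have "lo P $ k \<le> y $ k \<and> y $ k \<le> hi P $ k" for k
          using b[of k] s by (cases "k = j") auto
        then show ?thesis by (simp add: solid_box_mem[OF sP])
      qed
    qed
    also have "\<dots> \<subseteq> closure \<Omega>"
      using division_ofD(2)[OF division K] division_ofD(2)[OF division P] by blast
    finally have "?x \<in> interior (closure \<Omega>)"
      using x open_box interior_maximal by blast
    then show ?thesis
      using grid by (simp add: mac_grid_def interior_open)
  qed
  ultimately show False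
    using f by (auto simp: frontier_def)
qed

lemma grid_edges_dir_faces: "grid_edges_dir M i = {face b i K | b K. K \<in> M}"
  by (auto simp: grid_edges_dir_def cell_edges_dir_faces)

lemma face_in_grid_edges [simp]: "K \<in> M \<Longrightarrow> face b i K \<in> grid_edges M"
  by (auto simp: grid_edges_def grid_edges_dir_faces)

lemma int_edge_cells:
  assumes "\<sigma> \<in> int_edges \<Omega> M"
  obtains K L i where "K \<in> M" "L \<in> M" "\<sigma> = face True i K" "\<sigma> = face False i L"
proof -
  obtain K L where e: "edge_between \<Omega> M \<sigma> K L"
    using grid assms by (auto simp: mac_grid_def)
  then have KL: "K \<in> M" "L \<in> M" "K \<noteq> L"
    by (auto simp: edge_between_def)
  have "\<sigma> \<in> cell_edges K" "\<sigma> \<in> cell_edges L"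
    using e unfolding edge_between_def by metis+
  then obtain b i b' i' where \<sigma>: "\<sigma> = face b i K" "\<sigma> = face b' i' L"
    unfolding cell_edges_faces by blast
  then have "i = i'"
    using KL(1,2) face_direction_unique by metis
  moreover have "b \<noteq> b'"
  proof
    assume "b = b'"
    then have "K = L"
      using \<sigma> \<open>i = i'\<close> by (intro cell_of_face_unique[OF KL(1,2), of b i]) simp
    with KL show False by simp
  qed
  ultimately show ?thesis
    using that[of K L i] that[of L K i] KL(1,2) \<sigma> by (cases b; cases b') simp_all
qed

lemma int_edge_opposite_cell:
  assumes K: "K \<in> M" and f: "\<not> face b i K \<subseteq> frontier \<Omega>"
  obtains L where "L \<in> M" "face (\<not> b) i L = face b i K"
proof -
  have "face b i K \<in> int_edges \<Omega> M"
    using K f by (auto simp: int_edges_def ext_edges_def)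
  then obtain A B j where AB: "A \<in> M" "B \<in> M" "face b i K = face True j A" "face b i K = face False j B"
    by (rule int_edge_cells)
  moreover have "i = j"
    using face_direction_unique[OF K AB(1,3)] .
  ultimately show ?thesis
    using that[of A] that[of B] by (cases b) simp_all
qed

text \<open>
  The absence of hanging nodes in the form used below: cells in contact along a set of codimension one
  have the same transversal extents.  By the previous lemmas the touched face of \<open>K\<close> is internal and
  is thus a full face of some cell \<open>L\<close> on the other side; \<open>L\<close> and \<open>P\<close> overlap, so they are equal.
\<close>

lemma touching_cells_share_face:
  assumes K: "K \<in> M" and P: "P \<in> M" and s: "side b K $ j = side (\<not> b) P $ j"
    and ov: "\<And>k. k \<noteq> j \<Longrightarrow> overlap k K P"
  shows "face b j K = face (\<not> b) j P"
proof -
  have wlog: "face True j K = face False j P"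
    if K: "K \<in> M" and P: "P \<in> M" and s: "hi K $ j = lo P $ j"
      and ov: "\<And>k. k \<noteq> j \<Longrightarrow> overlap k K P" for K P
  proof -
    obtain L where L: "L \<in> M" "face False j L = face True j K"
      using int_edge_opposite_cell[OF K touching_face_not_in_frontier[OF K P s ov]]
      unfolding not_True_eq_False by blast
    note sol = cell_solid[OF K] cell_solid[OF P] cell_solid[OF L(1)]
    have "\<And>k. k \<noteq> j \<Longrightarrow> lo L $ k = lo K $ k \<and> hi L $ k = hi K $ k" "lo L $ j = hi K $ j"
      using L face_eq_iff[OF sol(3) sol(1)] by (auto simp: side_def)
    then have "overlap k L P" for k
      using ov[of k] s solid_boxD(2)[OF sol(3), of j] solid_boxD(2)[OF sol(2), of j]
      by (cases "k = j") (auto simp: overlap_def)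
    then have "L = P"
      using cells_eqI L(1) P by blast
    then show ?thesis using L by simp
  qed
  show ?thesis
  proof (cases b)
    case True
    have "face True j K = face False j P"
      by (rule wlog[OF K P]) (use True s ov in \<open>auto simp: side_def\<close>)
    then show ?thesis using True by simp
  next
    case False
    have "face True j P = face False j K"
      by (rule wlog[OF P K]) (use False s ov in \<open>auto simp: side_def overlap_def\<close>)
    then show ?thesis using False by simp
  qed
qed

lemma cells_of_internal_edge:
  assumes K: "K \<in> M" and L: "L \<in> M" and e: "face True i K = face False i L"
  shows "{A \<in> M. face True i K \<in> cell_edges A} = {K, L}" "K \<noteq> L"
proof -
  note s = cell_solid[OF K] cell_solid[OF L]
  have "A = K \<or> A = L" if A: "A \<in> M" "face True i K = face b j A" for A b j
  proof -
    have "i = j"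
      using face_direction_unique[OF K A] .
    show ?thesis
    proof (cases b)
      case True
      have "K = A"
        by (rule cell_of_face_unique[OF K A(1), of True i]) (use A(2) True \<open>i = j\<close> in simp)
      then show ?thesis by simp
    next
      case False
      have "L = A"
        by (rule cell_of_face_unique[OF L A(1), of False i], unfold e[symmetric])
          (use A(2) False \<open>i = j\<close> in simp)
      then show ?thesis by simp
    qed
  qed
  then show "{A \<in> M. face True i K \<in> cell_edges A} = {K, L}"
    using K L e unfolding cell_edges_faces by blast
  show "K \<noteq> L"
    using e face_eq_iff[OF s] solid_box_side_less[OF s(1), of i] by auto
qed

section \<open>Dual cells\<close>

lemma dual_cell_internal:
  assumes K: "K \<in> M" and L: "L \<in> M" and e: "face True i K = face False i L"
  shows "dual_cell M (face True i K) = cbox (set_coord (lo K) i (mid i K)) (set_coord (hi K) i (mid i L))"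
proof -
  note s = cell_solid[OF K] cell_solid[OF L]
  have eq: "lo K $ i < mid i K" "mid i K < hi K $ i" "hi K $ i = lo L $ i" "lo L $ i < mid i L" "mid i L < hi L $ i"
    "\<And>k. k \<noteq> i \<Longrightarrow> lo L $ k = lo K $ k \<and> hi L $ k = hi K $ k"
    using e face_eq_iff[OF s] solid_box_mid[OF s(1), of i] solid_box_mid[OF s(2), of i] by (auto simp: side_def)
  have "dual_cell M (face True i K) = half_cell (face True i K) K \<union> half_cell (face False i L) L"
    unfolding dual_cell_def cells_of_internal_edge[OF assms] using e by auto
  also have "\<dots> = cbox (set_coord (lo K) i (mid i K)) (hi K) \<union> cbox (lo L) (set_coord (hi L) i (mid i L))"
    by (simp add: half_cell_face s)
  also have "\<dots> = cbox (set_coord (lo K) i (mid i K)) (set_coord (hi K) i (mid i L))"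
    (is "cbox ?a ?b \<union> cbox ?c ?d = cbox ?a ?e")
  proof -
    have "(x \<in> cbox ?a ?b \<or> x \<in> cbox ?c ?d) \<longleftrightarrow> x \<in> cbox ?a ?e" for x
    proof -
      have r: "x \<in> cbox p q \<longleftrightarrow> (p $ i \<le> x $ i \<and> x $ i \<le> q $ i) \<and>
          (\<forall>k. k \<noteq> i \<longrightarrow> p $ k \<le> x $ k \<and> x $ k \<le> q $ k)" for p q :: "real ^ 'd"
        by (metis mem_box_cart(2))
      show ?thesis
        unfolding r using eq by auto
    qed
    then show ?thesis by blast
  qed
  finally show ?thesis .
qed

lemma dual_cell_external:
  assumes K: "K \<in> M" and n: "\<And>L. L \<in> M \<Longrightarrow> face (\<not> b) i L \<noteq> face b i K"
  shows "dual_cell M (face b i K) = half_cell (face b i K) K"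
proof -
  have "A = K" if A: "A \<in> M" "face b i K = face b' j A" for A b' j
  proof -
    have "i = j"
      using face_direction_unique[OF K A] .
    have "b' = b"
      using A(2) n[OF A(1)] \<open>i = j\<close> by (cases b; cases b') auto
    then have "K = A"
      using A(2) \<open>i = j\<close> by (intro cell_of_face_unique[OF K A(1), of b i]) simp
    then show ?thesis ..
  qed
  then have "{A \<in> M. face b i K \<in> cell_edges A} = {K}"
    using K by (auto simp: cell_edges_faces)
  then show ?thesis
    by (simp add: dual_cell_def)
qed

text \<open>
  Internal and external edges on the same footing: a dual cell reaches from the middle of the cell on
  one side of its edge to the middle of the cell on the other side, or only to the edge itself if
  there is no such cell.  The extents are stated relative to any adjacent cell \<open>K\<close>, so that for
  an internal edge the lemma can be applied to both.
\<close>

lemma dual_cell_bounds: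
  assumes K: "K \<in> M" and \<sigma>: "\<sigma> = face b i K"
  shows "solid_box (dual_cell M \<sigma>)"
    "k \<noteq> i \<Longrightarrow> lo (dual_cell M \<sigma>) $ k = lo K $ k \<and> hi (dual_cell M \<sigma>) $ k = hi K $ k"
    "side (\<not> b) (dual_cell M \<sigma>) $ i = mid i K"
    "(\<And>L. L \<in> M \<Longrightarrow> face (\<not> b) i L \<noteq> \<sigma>) \<Longrightarrow> side b (dual_cell M \<sigma>) $ i = side b K $ i"
proof -
  let ?D = "dual_cell M \<sigma>"
  note s = cell_solid[OF K]
  have "solid_box ?D \<and> (\<forall>k. k \<noteq> i \<longrightarrow> lo ?D $ k = lo K $ k \<and> hi ?D $ k = hi K $ k) \<and>
    side (\<not> b) ?D $ i = mid i K \<and>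
    ((\<forall>L\<in>M. face (\<not> b) i L \<noteq> \<sigma>) \<longrightarrow> side b ?D $ i = side b K $ i)"
  proof (cases "\<exists>L\<in>M. face (\<not> b) i L = \<sigma>")
    case True
    then obtain L where L: "L \<in> M" "face (\<not> b) i L = \<sigma>" by blast
    define A where "A = (if b then K else L)"
    define B where "B = (if b then L else K)"
    have AB: "A \<in> M" "B \<in> M" "face True i A = face False i B" "\<sigma> = face True i A"
      using K L \<sigma> by (auto simp: A_def B_def)
    note t = cell_solid[OF AB(1)] cell_solid[OF AB(2)]
    let ?a = "set_coord (lo A) i (mid i A)" and ?b = "set_coord (hi A) i (mid i B)"
    have eq: "hi A $ i = lo B $ i" "\<And>k. k \<noteq> i \<Longrightarrow> lo B $ k = lo A $ k \<and> hi B $ k = hi A $ k"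
      using AB(3) face_eq_iff[OF t] by (auto simp: side_def)
    have D: "?D = cbox ?a ?b"
      using dual_cell_internal[OF AB(1-3)] AB(4) by simp
    have ab: "?a $ k < ?b $ k" for k
      using eq solid_box_mid[OF t(1), of i] solid_box_mid[OF t(2), of i] solid_boxD(2)[OF t(1), of k] by auto
    have bd: "lo ?D = ?a" "hi ?D = ?b"
      unfolding D by (rule bounds_cbox_cart; use ab less_imp_le in blast)+
    have "solid_box ?D"
      unfolding D by (rule solid_box_cbox) (rule ab)
    then show ?thesis
      using True eq bd by (auto simp: A_def B_def side_def)
  next
    case False
    then have "?D = half_cell \<sigma> K"
      unfolding \<sigma> by (intro dual_cell_external[OF K]) (auto simp: \<sigma>)
    then have D: "?D = cbox (if b then set_coord (lo K) i (mid i K) else lo K)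
        (if b then hi K else set_coord (hi K) i (mid i K))" (is "_ = cbox ?a ?b")
      using half_cell_face[OF s] \<sigma> by auto
    have ab: "?a $ k < ?b $ k" for k
      using solid_box_mid[OF s, of i] solid_boxD(2)[OF s, of k] by auto
    have bd: "lo ?D = ?a" "hi ?D = ?b"
      unfolding D by (rule bounds_cbox_cart; use ab less_imp_le in blast)+
    have "solid_box ?D"
      unfolding D by (rule solid_box_cbox) (rule ab)
    then show ?thesis
      using False bd by (auto simp: side_def)
  qed
  then show "solid_box ?D" "k \<noteq> i \<Longrightarrow> lo ?D $ k = lo K $ k \<and> hi ?D $ k = hi K $ k"
    "side (\<not> b) ?D $ i = mid i K"
    "(\<And>L. L \<in> M \<Longrightarrow> face (\<not> b) i L \<noteq> \<sigma>) \<Longrightarrow> side b ?D $ i = side b K $ i"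
    by blast+
qed

end


lemma overlapI_side:
  assumes "solid_box A" "solid_box B" "side b A $ k = side b B $ k"
  shows "overlap k A B"
  using assms(3) solid_boxD(2)[OF assms(1), of k] solid_boxD(2)[OF assms(2), of k]
  by (cases b) (auto simp: overlap_def side_def)

lemma overlapI_extent:
  assumes "solid_box A" "lo A $ k = lo B $ k" "hi A $ k = hi B $ k"
  shows "overlap k A B"
  using assms(2,3) solid_boxD(2)[OF assms(1), of k] by (auto simp: overlap_def)

lemma overlap_cong:
  assumes "lo A $ k = lo A' $ k \<and> hi A $ k = hi A' $ k" "lo B $ k = lo B' $ k \<and> hi B $ k = hi B' $ k"
  shows "overlap k A B \<longleftrightarrow> overlap k A' B'"
  using assms by (simp add: overlap_def)

lemma side_cong: "lo A $ k = lo B $ k \<and> hi A $ k = hi B $ k \<Longrightarrow> side b A $ k = side b B $ k"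
  by (simp add: side_def)

lemma overlap_sym: "overlap k A B \<longleftrightarrow> overlap k B A"
  by (auto simp: overlap_def)

context conforming_grid
begin

lemma face_eqD:
  assumes "K \<in> M" "L \<in> M" "face b i K = face b' i L"
  shows "side b K $ i = side b' L $ i" "k \<noteq> i \<Longrightarrow> lo K $ k = lo L $ k \<and> hi K $ k = hi L $ k"
  using assms(3) face_eq_iff[OF cell_solid[OF assms(1)] cell_solid[OF assms(2)], of b i b' i] by blast+

lemma opposite_faces_differ: "K \<in> M \<Longrightarrow> face (\<not> b) i K \<noteq> face b i K"
  using face_eqD(1)[of K K "\<not> b" i b] solid_box_side_less[OF cell_solid, of K i] by (cases b) fastforce+

text \<open>
  Suppose that whenever a cell at \<open>\<sigma>'\<close> overlaps in direction \<open>i\<close> with a cell at \<open>\<sigma>\<close>, both have the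
  same extent in that direction.  Then two dual cells can overlap in direction \<open>i\<close> only if their
  edges lie at the same height: otherwise the dual cell of \<open>\<sigma>'\<close> would have to reach beyond the middle
  of a cell, but it ends there.  The hypothesis \<open>H\<close> holds for two different reasons, disjointness of
  cells and conformity, according to whether the dual cells overlap or touch in the other
  directions.
\<close>

lemma dual_overlap_aligned:
  assumes K: "K \<in> M" and L: "L \<in> M" and e: "face True i K = face False i L"
    and A: "A \<in> M"
    and ov: "overlap i (dual_cell M (face True i K)) (dual_cell M (face c i A))"
    and H: "\<And>B C b. \<lbrakk>B = K \<or> B = L; C \<in> M; face b i C = face c i A; overlap i C B\<rbrakk>
      \<Longrightarrow> lo C $ i = lo B $ i \<and> hi C $ i = hi B $ i"
  shows "side c A $ i = hi K $ i"
proof -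
  let ?D = "dual_cell M (face True i K)" and ?D' = "dual_cell M (face c i A)"
  let ?s = "hi K $ i" and ?s' = "side c A $ i"
  note sK = solid_box_mid[OF cell_solid[OF K], of i] and sL = solid_box_mid[OF cell_solid[OF L], of i]
    and sA = solid_box_mid[OF cell_solid[OF A], of i]
  have D: "lo ?D $ i = mid i K" "hi ?D $ i = mid i L"
    using dual_cell_bounds(3)[OF K refl, of True i] dual_cell_bounds(3)[OF L e] by (simp_all add: side_def)
  have s: "?s = lo L $ i"
    using face_eqD(1)[OF K L e] by (simp add: side_def)
  have o: "mid i K < hi ?D' $ i" "lo ?D' $ i < mid i L"
    using ov D by (simp_all add: overlap_def)
  \<comment> \<open>A dual cell ends at its edge or at the middle of a cell behind it.\<close>
  have ends: "(\<exists>C\<in>M. face b i C = face c i A \<and> side b C $ i = ?s' \<and> side (\<not> b) ?D' $ i = mid i C)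
      \<or> (c = (\<not> b) \<and> side (\<not> b) ?D' $ i = ?s')" for b
  proof (cases "\<exists>C\<in>M. face b i C = face c i A")
    case True
    then obtain C where C: "C \<in> M" "face b i C = face c i A" by blast
    then have "side b C $ i = ?s'"
      using face_eqD(1)[OF C(1) A C(2)] by simp
    moreover have "side (\<not> b) ?D' $ i = mid i C"
      using dual_cell_bounds(3)[OF C(1) C(2)[symmetric]] .
    ultimately show ?thesis using C by blast
  next
    case False
    then have c: "c = (\<not> b)" using A by (cases "c = b") auto
    have "side c ?D' $ i = side c A $ i"
      by (rule dual_cell_bounds(4)[OF A refl]) (use False c in auto)
    then show ?thesis using c by simp
  qed
  show ?thesis
  proof (rule linorder_cases[of ?s' ?s])
    assume lt: "?s' < ?s"
    consider (cell) R where "R \<in> M" "face False i R = face c i A" "lo R $ i = ?s'" "hi ?D' $ i = mid i R"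
      | (none) "c = True" "hi ?D' $ i = ?s'"
      using ends[of False] by (auto simp: side_def)
    then have False
    proof cases
      case cell
      note sR = solid_box_mid[OF cell_solid[OF cell(1)], of i]
      have "overlap i R K"
        using lt sK sR o cell by (auto simp: overlap_def)
      then have "mid i R = mid i K"
        using H[of K R False] cell by (simp add: mid_def)
      then show False using o cell by simp
    next
      case none
      have h: "?s' = hi A $ i" using none by (simp add: side_def)
      have "overlap i A K"
        using lt sK sA o none(2) h by (auto simp: overlap_def)
      then have "hi A $ i = hi K $ i"
        using H[of K A c] A by simp
      then show False using lt h by simp
    qed
    then show ?thesis ..
  next
    assume gt: "?s < ?s'"
    consider (cell) P where "P \<in> M" "face True i P = face c i A" "hi P $ i = ?s'" "lo ?D' $ i = mid i P"
      | (none) "c = False" "lo ?D' $ i = ?s'"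
      using ends[of True] by (auto simp: side_def)
    then have False
    proof cases
      case cell
      note sP = solid_box_mid[OF cell_solid[OF cell(1)], of i]
      have "overlap i P L"
        using gt s sL sP o cell by (auto simp: overlap_def)
      then have "mid i P = mid i L"
        using H[of L P True] cell by (simp add: mid_def)
      then show False using o cell by simp
    next
      case none
      have h: "?s' = lo A $ i" using none by (simp add: side_def)
      have "overlap i A L"
        using gt s sL sA o none(2) h by (auto simp: overlap_def)
      then have "lo A $ i = lo L $ i"
        using H[of L A c] A by simp
      then show False using gt h s by simp
    qed
    then show ?thesis ..
  qed
qed

text \<open>
  The transversal overlap passes from the dual cells to the cells around them, so any overlap of these
  in direction \<open>i\<close> makes them equal.  Alignment then leaves only a common adjacent cell.
\<close>

lemma dual_cells_disjoint:
  assumes K: "K \<in> M" and L: "L \<in> M" and e: "face True i K = face False i L" and A: "A \<in> M"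
    and ov: "\<And>k. overlap k (dual_cell M (face True i K)) (dual_cell M (face c i A))"
  shows "face c i A = face True i K"
proof -
  have ext: "overlap k C B" if "k \<noteq> i" "B = K \<or> B = L" "C \<in> M" "face b i C = face c i A" for k B C b
  proof -
    have 1: "lo (dual_cell M (face c i A)) $ k = lo C $ k \<and> hi (dual_cell M (face c i A)) $ k = hi C $ k"
      using dual_cell_bounds(2)[OF that(3) that(4)[symmetric] that(1)] .
    have 2: "lo (dual_cell M (face True i K)) $ k = lo B $ k \<and> hi (dual_cell M (face True i K)) $ k = hi B $ k"
      using dual_cell_bounds(2)[OF K refl that(1)] dual_cell_bounds(2)[OF L e that(1)] that(2) by auto
    show ?thesis
      using ov[of k] overlap_cong[OF 2 1] overlap_sym by blast
  qed
  have cells: "C = B" if "B = K \<or> B = L" "C \<in> M" "face b i C = face c i A" "overlap i C B" for B C b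
  proof (rule cells_eqI)
    show "overlap k C B" for k
      using that(4) ext[OF _ that(1-3)] by (cases "k = i") auto
    show "B \<in> M" using that(1) K L by blast
  qed (rule that(2))
  have s: "side c A $ i = hi K $ i"
    by (rule dual_overlap_aligned[OF K L e A ov]) (use cells in blast)
  show ?thesis
  proof (cases c)
    case True
    have "overlap i A K"
      by (rule overlapI_side[OF cell_solid[OF A] cell_solid[OF K], of True]) (use s True in \<open>simp add: side_def\<close>)
    then have "A = K" using cells[OF _ A refl] by blast
    then show ?thesis using True by simp
  next
    case False
    have "overlap i A L"
      by (rule overlapI_side[OF cell_solid[OF A] cell_solid[OF L], of False])
        (use s False face_eqD(1)[OF K L e] in \<open>simp add: side_def\<close>)
    then have "A = L" using cells[OF _ A refl] by blast
    then show ?thesis using False e by simp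
  qed
qed

lemma face_in_grid_edges_dir: "K \<in> M \<Longrightarrow> face b i K \<in> grid_edges_dir M j \<longleftrightarrow> j = i"
  using face_direction_unique[of K _ b i] by (fastforce simp: grid_edges_dir_faces)

text \<open>
  As dual cells do not overlap, a dual cell in contact with the face \<open>\<epsilon>\<close> of \<open>D\<^sub>\<sigma>\<close> must begin exactly
  where \<open>D\<^sub>\<sigma>\<close> ends.
\<close>

lemma dual_edge_between_iff:
  assumes K: "K \<in> M" and L: "L \<in> M" and e: "face True i K = face False i L"
    and \<sigma>: "\<sigma> = face True i K" and \<epsilon>: "\<epsilon> = face b j (dual_cell M \<sigma>)"
  shows "dual_edge_between M \<epsilon> \<sigma> \<sigma>' \<longleftrightarrow> (\<exists>c. \<exists>A\<in>M. \<sigma>' = face c i A) \<and> \<sigma> \<noteq> \<sigma>' \<and>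
    side (\<not> b) (dual_cell M \<sigma>') $ j = side b (dual_cell M \<sigma>) $ j \<and>
    (\<forall>k. k \<noteq> j \<longrightarrow> overlap k (dual_cell M \<sigma>) (dual_cell M \<sigma>'))" (is "_ \<longleftrightarrow> ?R")
proof -
  let ?D = "dual_cell M \<sigma>" and ?D' = "dual_cell M \<sigma>'"
  have D: "solid_box ?D" using dual_cell_bounds(1)[OF K \<sigma>] .
  have dir: "(\<exists>i. \<sigma> \<in> grid_edges_dir M i \<and> \<sigma>' \<in> grid_edges_dir M i) \<longleftrightarrow> (\<exists>c. \<exists>A\<in>M. \<sigma>' = face c i A)"
    unfolding \<sigma> using face_in_grid_edges_dir[OF K, of True i] by (auto simp: grid_edges_dir_faces)
  have "\<epsilon> \<in> cell_edges ?D"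
    using \<epsilon> by (auto simp: cell_edges_faces)
  then have def: "dual_edge_between M \<epsilon> \<sigma> \<sigma>' \<longleftrightarrow> (\<exists>c. \<exists>A\<in>M. \<sigma>' = face c i A) \<and> \<sigma> \<noteq> \<sigma>' \<and>
      aff_dim (\<epsilon> \<inter> ?D') = int CARD('d) - 1"
    unfolding dual_edge_between_def dir by blast
  show ?thesis
  proof (cases "(\<exists>c. \<exists>A\<in>M. \<sigma>' = face c i A) \<and> \<sigma> \<noteq> \<sigma>'")
    case True
    then obtain c A where A: "A \<in> M" "\<sigma>' = face c i A" by blast
    have D': "solid_box ?D'" using dual_cell_bounds(1)[OF A] .
    have no: "\<not> (\<forall>k. overlap k ?D ?D')"
      using dual_cells_disjoint[OF K L e A(1), of c] True A(2) \<sigma> by metis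
    have "aff_dim (\<epsilon> \<inter> ?D') = int CARD('d) - 1 \<longleftrightarrow>
      lo ?D' $ j \<le> side b ?D $ j \<and> side b ?D $ j \<le> hi ?D' $ j \<and> (\<forall>k. k \<noteq> j \<longrightarrow> overlap k ?D ?D')"
      unfolding \<epsilon> by (rule aff_dim_face_Int_box[OF D D'])
    also have "\<dots> \<longleftrightarrow> side (\<not> b) ?D' $ j = side b ?D $ j \<and> (\<forall>k. k \<noteq> j \<longrightarrow> overlap k ?D ?D')"
    proof (cases "\<forall>k. k \<noteq> j \<longrightarrow> overlap k ?D ?D'")
      case ov: True
      then have "\<not> overlap j ?D ?D'" using no by metis
      then show ?thesis
        using ov solid_boxD(2)[OF D, of j] solid_boxD(2)[OF D', of j]
        by (cases b) (auto simp: overlap_def side_def)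
    qed blast
    finally show ?thesis
      unfolding def using True by blast
  qed (use def in blast)
qed

text \<open>
  The face \<open>\<epsilon>\<close> is now the middle section of a cell \<open>B\<close> adjacent to \<open>\<sigma>\<close>, so nothing but the other
  half of \<open>B\<close> can lie behind it.
\<close>

lemma dual_neighbour_normal:
  assumes K: "K \<in> M" and L: "L \<in> M" and e: "face True i K = face False i L"
    and \<sigma>: "\<sigma> = face True i K"
    and nb: "dual_edge_between M (face b i (dual_cell M \<sigma>)) \<sigma> \<sigma>'"
  shows "\<sigma>' = face b i (if b then L else K)"
proof -
  let ?D = "dual_cell M \<sigma>" and ?D' = "dual_cell M \<sigma>'"
  define B where "B = (if b then L else K)"
  have B: "B \<in> M" "\<sigma> = face (\<not> b) i B"
    using K L e \<sigma> by (auto simp: B_def)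
  note sB = solid_box_mid[OF cell_solid[OF B(1)], of i]
  obtain c A where A: "A \<in> M" "\<sigma>' = face c i A"
    and s: "side (\<not> b) ?D' $ i = side b ?D $ i" and ov: "\<And>k. k \<noteq> i \<Longrightarrow> overlap k ?D ?D'"
    using nb unfolding dual_edge_between_iff[OF K L e \<sigma> refl] by blast
  have s: "side (\<not> b) ?D' $ i = mid i B"
    using s dual_cell_bounds(3)[OF B] by simp
  have eqB: "C = B" if "C \<in> M" "\<sigma>' = face d i C" "overlap i C B" for C d
  proof (rule cells_eqI[OF that(1) B(1)])
    show "overlap k C B" for k
    proof (cases "k = i")
      case False
      then show ?thesis
        using ov[OF False] overlap_sym
          overlap_cong[OF dual_cell_bounds(2)[OF B False] dual_cell_bounds(2)[OF that(1,2) False]] by blast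
    qed (use that in simp)
  qed
  have far: "\<sigma>' = face b i B" if C: "C \<in> M" "\<sigma>' = face b i C" for C
  proof -
    note sC = solid_box_mid[OF cell_solid[OF C(1)], of i]
    have "mid i C = mid i B"
      using dual_cell_bounds(3)[OF C] s by simp
    then have "overlap i C B"
      using sC sB by (simp add: overlap_def)
    then show ?thesis using eqB[OF C] C by simp
  qed
  show ?thesis
  proof (cases "\<exists>C\<in>M. \<sigma>' = face b i C")
    case True
    then show ?thesis using far unfolding B_def by blast
  next
    case False
    then have c: "c = (\<not> b)" using A by (cases "c = b") auto
    have "side (\<not> b) ?D' $ i = side (\<not> b) A $ i"
      by (rule dual_cell_bounds(4)[OF A[unfolded c]]) (use False in auto)
    then have m: "side (\<not> b) A $ i = mid i B" using s by simp
    then have "overlap i A B"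
      using sB solid_boxD(2)[OF cell_solid[OF A(1)], of i] by (cases b) (auto simp: overlap_def side_def)
    then have "A = B" using eqB[OF A] by simp
    then have False using m sB by (cases b) (auto simp: side_def)
    then show ?thesis ..
  qed
qed

text \<open>
  Now \<open>\<epsilon>\<close> consists of halves of a face of \<open>K\<close> and of a face of \<open>L\<close>.  The cell of \<open>\<sigma>'\<close> on the same
  side as \<open>K\<close> (or \<open>L\<close>) is the cell behind that face.  At a re-entrant corner only one of the two
  exists, and then \<open>\<sigma>'\<close> is external.
\<close>

lemma dual_neighbour_lateral:
  assumes K: "K \<in> M" and L: "L \<in> M" and e: "face True i K = face False i L"
    and \<sigma>: "\<sigma> = face True i K" and j: "j \<noteq> i"
    and nb: "dual_edge_between M (face b j (dual_cell M \<sigma>)) \<sigma> (face c i A)" and A: "A \<in> M"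
  shows "face (\<not> b) j A = face b j (if c then K else L)"
proof -
  let ?D = "dual_cell M \<sigma>" and ?D' = "dual_cell M (face c i A)"
  have s: "side (\<not> b) ?D' $ j = side b ?D $ j" and ov: "\<And>k. k \<noteq> j \<Longrightarrow> overlap k ?D ?D'"
    using nb unfolding dual_edge_between_iff[OF K L e \<sigma> refl] by blast+
  have share: "face b j B = face (\<not> b) j C"
    if B: "B = K \<or> B = L" and C: "C \<in> M" "face d i C = face c i A" and o: "overlap i C B" for B C d
  proof -
    have BM: "B \<in> M" using B K L by blast
    have DB: "lo ?D $ k = lo B $ k \<and> hi ?D $ k = hi B $ k" if "k \<noteq> i" for k
      using dual_cell_bounds(2)[OF K \<sigma> that] dual_cell_bounds(2)[OF L e[folded \<sigma>] that] B by auto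
    have DC: "lo ?D' $ k = lo C $ k \<and> hi ?D' $ k = hi C $ k" if "k \<noteq> i" for k
      using dual_cell_bounds(2)[OF C(1) C(2)[symmetric] that] .
    show ?thesis
    proof (rule touching_cells_share_face[OF BM C(1)])
      show "side b B $ j = side (\<not> b) C $ j"
        using s side_cong[OF DB[OF j]] side_cong[OF DC[OF j]] by metis
      show "overlap k B C" if "k \<noteq> j" for k
      proof (cases "k = i")
        case True
        then show ?thesis using o overlap_sym by blast
      next
        case False
        then show ?thesis using ov[OF that] overlap_cong[OF DB[OF False] DC[OF False]] by blast
      qed
    qed
  qed
  have al: "side c A $ i = hi K $ i"
  proof (rule dual_overlap_aligned[OF K L e A])
    show "overlap i (dual_cell M (face True i K)) ?D'"
      using ov[of i] j \<sigma> by auto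
  next
    fix B C d
    assume h: "B = K \<or> B = L" "C \<in> M" "face d i C = face c i A" "overlap i C B"
    have "B \<in> M" using h(1) K L by blast
    from face_eqD(2)[OF this h(2) share[OF h], of i] j
    show "lo C $ i = lo B $ i \<and> hi C $ i = hi B $ i" by simp
  qed
  have "overlap i A (if c then K else L)"
  proof (rule overlapI_side[OF cell_solid[OF A], of _ c])
    show "solid_box (if c then K else L)" using cell_solid K L by simp
    show "side c A $ i = side c (if c then K else L) $ i"
      using al face_eqD(1)[OF K L e] by (cases c) (auto simp: side_def)
  qed
  then show ?thesis
    using share[of "if c then K else L" A c] A by auto
qed

text \<open>
  For a lateral face, one candidate could come from the cell \<open>B1\<close> behind the face of \<open>K\<close> and the
  other from the cell \<open>B2\<close> behind the face of \<open>L\<close>; but then \<open>B1\<close> and \<open>B2\<close> are in contact and share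
  the face in question.
\<close>

lemma dual_neighbour_unique:
  assumes \<sigma>: "\<sigma> \<in> int_edges \<Omega> M" and \<epsilon>: "\<epsilon> \<in> cell_edges (dual_cell M \<sigma>)"
    and nb: "dual_edge_between M \<epsilon> \<sigma> \<sigma>\<^sub>1" "dual_edge_between M \<epsilon> \<sigma> \<sigma>\<^sub>2"
  shows "\<sigma>\<^sub>1 = \<sigma>\<^sub>2"
proof -
  obtain K L i where KL: "K \<in> M" "L \<in> M" "\<sigma> = face True i K" "\<sigma> = face False i L"
    using int_edge_cells[OF \<sigma>] .
  have e: "face True i K = face False i L" using KL by simp
  obtain b j where \<epsilon>: "\<epsilon> = face b j (dual_cell M \<sigma>)"
    using \<epsilon> unfolding cell_edges_faces by blast
  note n1 = nb(1)[unfolded \<epsilon>] and n2 = nb(2)[unfolded \<epsilon>]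
  show ?thesis
  proof (cases "j = i")
    case True
    show ?thesis
      using dual_neighbour_normal[OF KL(1,2) e KL(3) n1[unfolded True]]
        dual_neighbour_normal[OF KL(1,2) e KL(3) n2[unfolded True]] by simp
  next
    case False
    obtain c1 A1 c2 A2 where A: "A1 \<in> M" "\<sigma>\<^sub>1 = face c1 i A1" "A2 \<in> M" "\<sigma>\<^sub>2 = face c2 i A2"
      using n1 n2 unfolding dual_edge_between_iff[OF KL(1,2) e KL(3) refl] by blast
    note f1 = dual_neighbour_lateral[OF KL(1,2) e KL(3) False n1[unfolded A(2)] A(1)]
    note f2 = dual_neighbour_lateral[OF KL(1,2) e KL(3) False n2[unfolded A(4)] A(3)]
    have opp: "face True i B1 = face False i B2"
      if B: "B1 \<in> M" "B2 \<in> M" and f: "face (\<not> b) j B1 = face b j K" "face (\<not> b) j B2 = face b j L" for B1 B2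
    proof -
      note x1 = face_eqD[OF B(1) KL(1) f(1)] and x2 = face_eqD[OF B(2) KL(2) f(2)]
      have x: "k \<noteq> i \<Longrightarrow> lo K $ k = lo L $ k \<and> hi K $ k = hi L $ k" "hi K $ i = lo L $ i" for k
        using face_eqD[OF KL(1,2) e] by (auto simp: side_def)
      have "face True i B1 = face (\<not> True) i B2"
      proof (rule touching_cells_share_face[OF B])
        show "side True B1 $ i = side (\<not> True) B2 $ i"
          using x1(2)[of i] x2(2)[of i] x(2) False by (simp add: side_def)
        fix k assume k: "k \<noteq> i"
        show "overlap k B1 B2"
        proof (cases "k = j")
          case True
          have "side (\<not> b) B1 $ j = side (\<not> b) B2 $ j"
            using x1(1) x2(1) side_cong[OF x(1)[of j]] False by simp
          then show ?thesis
            using True overlapI_side[OF cell_solid[OF B(1)] cell_solid[OF B(2)]] by blast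
        next
          case False
          then show ?thesis
            using x1(2)[of k] x2(2)[of k] x(1)[OF k] by (intro overlapI_extent cell_solid B(1)) auto
        qed
      qed
      then show ?thesis by simp
    qed
    consider "c1 = c2" | "c1" "\<not> c2" | "\<not> c1" "c2" by blast
    then show ?thesis
    proof cases
      case 1
      then have "A1 = A2"
        using f1 f2 by (intro cell_of_face_unique[OF A(1,3), of "\<not> b" j]) simp
      then show ?thesis using 1 A by simp
    next
      case 2
      then show ?thesis using opp[OF A(1,3)] f1 f2 A by simp
    next
      case 3
      then show ?thesis using opp[OF A(3,1)] f1 f2 A by simp
    qed
  qed
qed

text \<open>
  The point is that \<open>\<epsilon>\<close> is a full face of the dual cell of \<open>\<sigma>'\<close> as well, because both dual cells
  have the same transversal extents.  This can fail if \<open>\<sigma>'\<close> is external, since its dual cell may then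
  cover only one half of \<open>\<epsilon>\<close>.
\<close>

lemma dual_edge_between_sym:
  assumes \<sigma>: "\<sigma> \<in> int_edges \<Omega> M" and \<sigma>': "\<sigma>' \<in> int_edges \<Omega> M"
    and nb: "dual_edge_between M \<epsilon> \<sigma> \<sigma>'"
  shows "dual_edge_between M \<epsilon> \<sigma>' \<sigma>"
proof -
  let ?D = "dual_cell M \<sigma>" and ?D' = "dual_cell M \<sigma>'"
  obtain K L i where KL: "K \<in> M" "L \<in> M" "\<sigma> = face True i K" "\<sigma> = face False i L"
    using int_edge_cells[OF \<sigma>] .
  have e: "face True i K = face False i L" using KL by simp
  have "\<epsilon> \<in> cell_edges ?D"
    using nb by (simp add: dual_edge_between_def)
  then obtain b j where \<epsilon>: "\<epsilon> = face b j ?D"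
    unfolding cell_edges_faces by blast
  note n = nb[unfolded \<epsilon>]
  obtain c A where A: "A \<in> M" "\<sigma>' = face c i A" and s: "side (\<not> b) ?D' $ j = side b ?D $ j"
    using n unfolding dual_edge_between_iff[OF KL(1,2) e KL(3) refl] by blast
  have D: "solid_box ?D" "solid_box ?D'"
    using dual_cell_bounds(1)[OF KL(1,3)] dual_cell_bounds(1)[OF A] .
  have ext: "lo ?D' $ k = lo ?D $ k \<and> hi ?D' $ k = hi ?D $ k" if k: "k \<noteq> j" for k
  proof (cases "j = i")
    case True
    define B where "B = (if b then L else K)"
    have B: "B \<in> M" "\<sigma> = face (\<not> b) i B" "\<sigma>' = face b i B"
      using KL dual_neighbour_normal[OF KL(1,2) e KL(3) n[unfolded True]] by (auto simp: B_def)
    show ?thesis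
      using dual_cell_bounds(2)[OF B(1,2)] dual_cell_bounds(2)[OF B(1,3)] k True by simp
  next
    case False
    obtain P R i' where PR: "P \<in> M" "R \<in> M" "\<sigma>' = face True i' P" "\<sigma>' = face False i' R"
      using int_edge_cells[OF \<sigma>'] .
    have [simp]: "i' = i"
      by (rule face_direction_unique[OF PR(1) A(1), of True i' c i]) (use PR A in simp)
    have P: "\<sigma>' = face True i P" and R: "\<sigma>' = face False i R" using PR by simp_all
    have fP: "face (\<not> b) j P = face b j K"
      using dual_neighbour_lateral[OF KL(1,2) e KL(3) False n[unfolded P] PR(1)] by simp
    have fR: "face (\<not> b) j R = face b j L"
      using dual_neighbour_lateral[OF KL(1,2) e KL(3) False n[unfolded R] PR(2)] by simp
    show ?thesis
    proof (cases "k = i")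
      case True
      have "mid i P = mid i K" "mid i R = mid i L"
        using face_eqD(2)[OF PR(1) KL(1) fP, of i] face_eqD(2)[OF PR(2) KL(2) fR, of i] False
        by (auto simp: mid_def)
      then show ?thesis
        using True dual_cell_bounds(3)[OF KL(1,3)] dual_cell_bounds(3)[OF KL(2,4)]
          dual_cell_bounds(3)[OF PR(1) P] dual_cell_bounds(3)[OF PR(2) R] by (simp add: side_def)
    next
      case ki: False
      show ?thesis
        using dual_cell_bounds(2)[OF KL(1,3) ki] dual_cell_bounds(2)[OF PR(1) P ki]
          face_eqD(2)[OF PR(1) KL(1) fP k] by simp
    qed
  qed
  have \<epsilon>': "\<epsilon> = face (\<not> b) j ?D'"
    unfolding \<epsilon> by (subst face_eq_iff[OF D]) (use s ext in simp)
  then have "\<epsilon> \<inter> ?D = \<epsilon> \<inter> ?D'"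
    using \<epsilon> face_mem by blast
  moreover have "\<epsilon> \<in> cell_edges ?D'"
    using \<epsilon>' unfolding cell_edges_faces by blast
  ultimately show ?thesis
    using nb unfolding dual_edge_between_def by auto
qed

text \<open>
  A lateral face is covered by a face of \<open>K\<close> and one of \<open>L\<close>; one of these is not in the boundary and
  has a cell behind it, which supplies the neighbour.
\<close>

lemma dual_neighbour_exists:
  assumes \<sigma>: "\<sigma> \<in> int_edges \<Omega> M" and \<epsilon>: "\<epsilon> \<in> cell_edges (dual_cell M \<sigma>)" "\<not> \<epsilon> \<subseteq> frontier \<Omega>"
  shows "\<exists>\<sigma>'. dual_edge_between M \<epsilon> \<sigma> \<sigma>'"
proof -
  let ?D = "dual_cell M \<sigma>"
  obtain K L i where KL: "K \<in> M" "L \<in> M" "\<sigma> = face True i K" "\<sigma> = face False i L"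
    using int_edge_cells[OF \<sigma>] .
  have e: "face True i K = face False i L" using KL by simp
  obtain b j where \<epsilon>': "\<epsilon> = face b j ?D"
    using \<epsilon>(1) unfolding cell_edges_faces by blast
  note iff = dual_edge_between_iff[OF KL(1,2) e KL(3) \<epsilon>']
  have D: "solid_box ?D"
    using dual_cell_bounds(1)[OF KL(1,3)] .
  show ?thesis
  proof (cases "j = i")
    case True
    define B where "B = (if b then L else K)"
    have B: "B \<in> M" "\<sigma> = face (\<not> b) i B"
      using KL by (auto simp: B_def)
    let ?\<sigma>' = "face b i B"
    have "\<sigma> \<noteq> ?\<sigma>'"
      using B opposite_faces_differ by simp
    moreover have "side (\<not> b) (dual_cell M ?\<sigma>') $ j = side b ?D $ j"
      using dual_cell_bounds(3)[OF B(1) refl, of b i] dual_cell_bounds(3)[OF B] True by simp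
    moreover have "overlap k ?D (dual_cell M ?\<sigma>')" if "k \<noteq> j" for k
      using dual_cell_bounds(2)[OF B, of k] dual_cell_bounds(2)[OF B(1) refl, of k i b] that True
      by (intro overlapI_extent D) auto
    ultimately show ?thesis
      unfolding iff using B(1) by blast
  next
    case False
    have "\<epsilon> \<subseteq> face b j K \<union> face b j L"
    proof
      fix x assume "x \<in> \<epsilon>"
      then have x: "x \<in> ?D" "x $ j = side b ?D $ j" by (simp_all add: \<epsilon>' face_mem)
      have xk: "lo ?D $ k \<le> x $ k \<and> x $ k \<le> hi ?D $ k" for k
        using x(1) solid_box_mem[OF D] by blast
      note bK = dual_cell_bounds[OF KL(1,3)] and bL = dual_cell_bounds[OF KL(2,4)]
      have s: "hi K $ i = lo L $ i"
        using face_eqD(1)[OF KL(1,2) e] by (simp add: side_def)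
      show "x \<in> face b j K \<union> face b j L"
      proof (cases "x $ i \<le> hi K $ i")
        case True
        have "lo K $ k \<le> x $ k \<and> x $ k \<le> hi K $ k" for k
          using xk[of k] bK(2)[of k] bK(3) solid_box_mid[OF cell_solid[OF KL(1)], of i] True
          by (cases "k = i") (auto simp: side_def)
        then have "x \<in> K" using solid_box_mem[OF cell_solid[OF KL(1)]] by blast
        moreover have "x $ j = side b K $ j"
          using x(2) side_cong[OF bK(2)[OF False]] by simp
        ultimately show ?thesis by (simp add: face_mem)
      next
        case gt: False
        have "lo L $ k \<le> x $ k \<and> x $ k \<le> hi L $ k" for k
          using xk[of k] bL(2)[of k] bL(3) solid_box_mid[OF cell_solid[OF KL(2)], of i] gt s
          by (cases "k = i") (auto simp: side_def)
        then have "x \<in> L" using solid_box_mem[OF cell_solid[OF KL(2)]] by blast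
        moreover have "x $ j = side b L $ j"
          using x(2) side_cong[OF bL(2)[OF False]] by simp
        ultimately show ?thesis by (simp add: face_mem)
      qed
    qed
    then have "\<not> face b j K \<subseteq> frontier \<Omega> \<or> \<not> face b j L \<subseteq> frontier \<Omega>"
      using \<epsilon>(2) by blast
    then obtain B c where B: "B \<in> M" "\<sigma> = face c i B" "\<not> face b j B \<subseteq> frontier \<Omega>"
      using KL by blast
    obtain C where C: "C \<in> M" "face (\<not> b) j C = face b j B"
      using int_edge_opposite_cell[OF B(1,3)] .
    note x = face_eqD[OF C(1) B(1) C(2)]
    let ?\<sigma>' = "face c i C"
    have "\<sigma> \<noteq> ?\<sigma>'"
    proof
      assume "\<sigma> = ?\<sigma>'"
      then have "B = C"
        using B by (intro cell_of_face_unique[OF B(1) C(1), of c i]) simp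
      then show False
        using C(2) opposite_faces_differ[OF B(1)] by simp
    qed
    moreover have "side (\<not> b) (dual_cell M ?\<sigma>') $ j = side b ?D $ j"
      using side_cong[OF dual_cell_bounds(2)[OF C(1) refl False]] side_cong[OF dual_cell_bounds(2)[OF B(1,2) False]] x(1)
      by simp
    moreover have "overlap k ?D (dual_cell M ?\<sigma>')" if k: "k \<noteq> j" for k
    proof (cases "k = i")
      case True
      have "mid i C = mid i B" using x(2)[of i] False by (simp add: mid_def)
      then have "side (\<not> c) ?D $ i = side (\<not> c) (dual_cell M ?\<sigma>') $ i"
        using dual_cell_bounds(3)[OF B(1,2)] dual_cell_bounds(3)[OF C(1) refl, of c i] by simp
      then show ?thesis
        using True overlapI_side[OF D dual_cell_bounds(1)[OF C(1) refl]] by blast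
    next
      case ki: False
      show ?thesis
        using dual_cell_bounds(2)[OF B(1,2) ki] dual_cell_bounds(2)[OF C(1) refl ki, of c] x(2)[OF k]
        by (intro overlapI_extent D) auto
    qed
    ultimately show ?thesis
      unfolding iff using C(1) by blast
  qed
qed

end


section \<open>The local kinetic energy estimate\<close>

text \<open>
  The estimate on one dual cell, free of geometry: \<open>X\<close> is the set of its faces, \<open>G\<close> the mass flux,
  \<open>w\<close> the upwind velocity, \<open>v\<close> and \<open>v'\<close> the old and new velocities, \<open>r\<close> and \<open>r'\<close> the old and new
  dual densities, \<open>R\<close> the edge density, \<open>P\<close> and \<open>C\<close> the derivatives of the potential and of
  \<open>\<Lambda>\<close>, and \<open>d\<close> the volume of the dual cell.  The three terms on the right are left for summation over
  the grid: the work of \<open>\<Lambda>\<close>, the part of the explicit-time error that \<open>\<eta>\<close> controls, and the part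
  that \<open>\<Lambda>\<close> controls.
\<close>

lemma edge_kinetic_estimate:
  fixes G w :: "'a \<Rightarrow> real" and v v' r r' R P C d dt eta :: real
  assumes pos: "r' > 0" "d > 0" "dt > 0"
    and mass: "1 / dt * (r' - r) + 1 / d * (\<Sum>x\<in>X. G x) = 0"
    and mom: "1 / dt * (r' * v' - r * v) + 1 / d * (\<Sum>x\<in>X. G x * w x) = - R * P + C"
    and upw: "\<And>x. x \<in> X \<Longrightarrow> G x \<ge> 0 \<Longrightarrow> w x = v"
    and X: "finite X"
    and cfl: "(\<Sum>x\<in>X. - neg_part (G x)) \<noteq> 0 \<Longrightarrow> dt \<le> r' * d / (4 * (\<Sum>x\<in>X. - neg_part (G x)))"
    and eta: "eta \<ge> R^2 / r'"
  shows "1/2 * (d / dt) * (r' * v'^2 - r * v^2) + 1/2 * (\<Sum>x\<in>X. G x * (w x)^2) + d * R * v * P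
    \<le> d * v * C + eta * dt * (d * P^2) + 2 * dt * d * C^2 / r'"
proof -
  define N where "N x = - neg_part (G x)" for x
  define S where "S = (\<Sum>x\<in>X. N x)"
  define T where "T = (\<Sum>x\<in>X. N x * (w x - v)^2)"
  define A where "A = (\<Sum>x\<in>X. N x * (w x - v)) / d"
  have N0: "N x \<ge> 0" for x by (simp add: N_def neg_part_def)
  \<comment> \<open>Only inflow faces see a velocity different from \<open>v\<close>.\<close>
  have GN: "G x * (w x - v) = - N x * (w x - v)" if "x \<in> X" for x
    using upw[OF that] by (cases "G x \<ge> 0") (auto simp: N_def neg_part_def)
  have S0: "S \<ge> 0" and T0: "T \<ge> 0" unfolding S_def T_def by (auto intro!: sum_nonneg mult_nonneg_nonneg N0)
  have sumG: "(\<Sum>x\<in>X. G x) = - d / dt * (r' - r)"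
    using mass pos by (simp add: field_simps)
  have sumGw: "(\<Sum>x\<in>X. G x * w x) = d * (- R * P + C) - d / dt * (r' * v' - r * v)"
    using mom pos by (simp add: field_simps)
  have "- (d * A) = (\<Sum>x\<in>X. G x * (w x - v))"
    using pos by (simp add: A_def GN sum_negf)
  also have "\<dots> = (\<Sum>x\<in>X. G x * w x) - v * (\<Sum>x\<in>X. G x)"
    by (simp add: algebra_simps sum_subtractf sum_distrib_left)
  finally have "r' * (v' - v) * d = d * (dt * (A - R * P + C))"
    using pos unfolding sumG sumGw by (simp add: field_simps)
  then have inc: "r' * (v' - v) = dt * (A - R * P + C)"
    using pos by simp
  \<comment> \<open>\<open>T\<close> is the upwind dissipation, to be balanced against the term \<open>A\<^sup>2\<close>.\<close>
  have "- T = (\<Sum>x\<in>X. G x * (w x - v) * (w x - v))"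
    unfolding T_def sum_negf[symmetric] by (rule sum.cong) (simp_all add: GN power2_eq_square)
  also have "\<dots> = (\<Sum>x\<in>X. G x * (w x)^2) - 2 * v * (\<Sum>x\<in>X. G x * w x) + v^2 * (\<Sum>x\<in>X. G x)"
    by (simp add: algebra_simps power2_eq_square sum_subtractf sum.distrib sum_distrib_left)
  finally have sumGw2: "(\<Sum>x\<in>X. G x * (w x)^2) = - T + 2 * v * (\<Sum>x\<in>X. G x * w x) - v^2 * (\<Sum>x\<in>X. G x)"
    by simp
  have "1/2 * (d / dt) * (r' * v'^2 - r * v^2) + 1/2 * (\<Sum>x\<in>X. G x * (w x)^2) + d * R * v * P
    = d * v * C - T / 2 + d / (2 * dt) * (r' * (v' - v)^2)"
    unfolding sumGw2 sumG sumGw using pos by (simp add: field_simps power2_eq_square)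
  also have "d / (2 * dt) * (r' * (v' - v)^2) = d * dt / (2 * r') * (A - R * P + C)^2"
  proof -
    have "r' * (r' * (v' - v)^2) = (r' * (v' - v))^2" by (simp add: power2_eq_square)
    also have "\<dots> = dt^2 * (A - R * P + C)^2" unfolding inc by (simp add: power_mult_distrib)
    finally have "r' * (v' - v)^2 = dt^2 * (A - R * P + C)^2 / r'"
      using pos by (simp add: eq_divide_eq mult.commute)
    then show ?thesis using pos by (simp add: power2_eq_square[of dt])
  qed
  also have "\<dots> \<le> d * dt / (2 * r') * (4 * A^2 + 2 * (R * P)^2 + 4 * C^2)"
  proof (rule mult_left_mono)
    \<comment> \<open>The defect of the weighted Cauchy-Schwarz inequality as a sum of squares.\<close>
    have "4 * A^2 + 2 * (R * P)^2 + 4 * C^2 - (A - R * P + C)^2 = (A - C)^2 + 2 * (A + R * P / 2)^2 + 2 * (C + R * P / 2)^2"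
      by (simp add: power2_eq_square algebra_simps)
    moreover have "\<dots> \<ge> 0" by simp
    ultimately show "(A - R * P + C)^2 \<le> 4 * A^2 + 2 * (R * P)^2 + 4 * C^2" by linarith
  qed (use pos in simp)
  also have "\<dots> = 2 * d * dt / r' * A^2 + d * dt * (R^2 / r') * P^2 + 2 * dt * d * C^2 / r'"
    using pos by (simp add: field_simps power2_eq_square)
  also have "2 * d * dt / r' * A^2 \<le> T / 2"
  proof (cases "S = 0")
    case True
    then have "N x = 0" if "x \<in> X" for x
      using that X N0 unfolding S_def by (simp add: sum_nonneg_eq_0_iff)
    then have "A = 0" by (simp add: A_def)
    then show ?thesis using T0 by simp
  next
    case False
    then have "dt * S \<le> r' * d / 4"
      using cfl S0 pos unfolding S_def N_def by (simp add: field_simps)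
    have "(d * A)^2 = (\<Sum>x\<in>X. sqrt (N x) * (sqrt (N x) * (w x - v)))^2"
      using pos N0 by (simp add: A_def mult.assoc[symmetric])
    also have "\<dots> \<le> (\<Sum>x\<in>X. (sqrt (N x))^2) * (\<Sum>x\<in>X. (sqrt (N x) * (w x - v))^2)"
      by (rule Cauchy_Schwarz_ineq_sum)
    also have "\<dots> = S * T"
      using N0 by (simp add: S_def T_def power_mult_distrib)
    finally have cs: "(d * A)^2 \<le> S * T" .
    have "2 * d * dt / r' * A^2 = 2 * dt / (r' * d) * (d * A)^2"
      using pos by (simp add: field_simps power2_eq_square)
    also have "\<dots> \<le> 2 * dt / (r' * d) * (S * T)"
      using cs pos by (intro mult_left_mono) auto
    also have "\<dots> = 2 / (r' * d) * (dt * S) * T" by simp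
    also have "\<dots> \<le> 2 / (r' * d) * (r' * d / 4) * T"
      using \<open>dt * S \<le> r' * d / 4\<close> pos T0 by (intro mult_right_mono mult_left_mono) auto
    also have "\<dots> = T / 2" using pos by simp
    finally show ?thesis .
  qed
  also have "d * dt * (R^2 / r') * P^2 \<le> d * dt * eta * P^2"
    using eta pos by (intro mult_right_mono mult_left_mono) auto
  finally show ?thesis by (simp add: algebra_simps)
qed

text \<open>
  The internal energy \<open>e\<^sup>\<phi> (\<phi> - 1)\<close> is the convex function \<open>s ln s - s\<close> of \<open>s = e\<^sup>\<phi>\<close>, with derivative
  \<open>\<phi>\<close>; the tangent at the new value lies below it.
\<close>

lemma exp_energy_convex:
  fixes a b :: real
  shows "exp b * (b - 1) - exp a * (a - 1) \<le> b * (exp b - exp a)"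
proof -
  have "exp a * (1 + (b - a)) \<le> exp a * exp (b - a)"
    by (intro mult_left_mono exp_ge_add_one_self) auto
  also have "\<dots> = exp b" by (simp flip: exp_add)
  finally show ?thesis by (simp add: algebra_simps)
qed

section \<open>Discrete calculus on the grid\<close>

context conforming_grid
begin

abbreviation "E \<equiv> int_edges \<Omega> M"
abbreviation "near \<sigma> \<equiv> fst (adjacent_cells \<Omega> M \<sigma>)"
abbreviation "far \<sigma> \<equiv> snd (adjacent_cells \<Omega> M \<sigma>)"
abbreviation "D \<sigma> \<equiv> vol (dual_cell M \<sigma>)"
abbreviation "grad q \<sigma> \<equiv> edge_deriv \<Omega> M q \<sigma>"
abbreviation "avg q \<sigma> \<equiv> dual_average \<Omega> M q \<sigma>"

definition orient :: "'d edge \<Rightarrow> real" where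
  "orient \<sigma> = axis (edge_dir \<sigma>) 1 \<bullet> outer_normal \<sigma> (near \<sigma>)"

lemma finite_edges [simp]: "finite (grid_edges M)" "finite E"
proof -
  show f: "finite (grid_edges M)"
    by (simp add: grid_edges_def grid_edges_dir_def cell_edges_dir_def)
  show "finite E"
    by (rule finite_subset[OF _ f]) (auto simp: int_edges_def)
qed

lemma cell_edges_subset: "K \<in> M \<Longrightarrow> cell_edges K \<subseteq> grid_edges M"
  by (auto simp: cell_edges_faces)

lemma grid_edges_Un: "grid_edges M = E \<union> ext_edges \<Omega> M" "E \<inter> ext_edges \<Omega> M = {}"
  by (auto simp: int_edges_def ext_edges_def)

text \<open>
  All that the summations below need to know about an internal edge: it has exactly two adjacent cells,
  from which its normals point in opposite directions, and all measures are positive.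
\<close>

lemma adjacent:
  assumes \<sigma>: "\<sigma> \<in> E"
  shows "near \<sigma> \<in> M" "far \<sigma> \<in> M" "near \<sigma> \<noteq> far \<sigma>" "{A \<in> M. \<sigma> \<in> cell_edges A} = {near \<sigma>, far \<sigma>}"
    and "orient \<sigma> = 1 \<or> orient \<sigma> = -1"
    and "axis (edge_dir \<sigma>) 1 \<bullet> outer_normal \<sigma> (far \<sigma>) = - orient \<sigma>"
    and "vol (half_cell \<sigma> (near \<sigma>)) > 0" "vol (half_cell \<sigma> (far \<sigma>)) > 0" "D \<sigma> > 0" "area \<sigma> > 0"
proof -
  have "\<exists>p. (\<lambda>(K, L). edge_between \<Omega> M \<sigma> K L) p"
    using grid \<sigma> by (auto simp: mac_grid_def)
  from someI_ex[OF this] have "edge_between \<Omega> M \<sigma> (near \<sigma>) (far \<sigma>)"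
    unfolding adjacent_cells_def case_prod_unfold .
  note eb = this
  show nf: "near \<sigma> \<in> M" "far \<sigma> \<in> M" "near \<sigma> \<noteq> far \<sigma>"
    using eb unfolding edge_between_def by blast+
  have c: "\<sigma> \<in> cell_edges (near \<sigma>)" "\<sigma> \<in> cell_edges (far \<sigma>)"
    using eb unfolding edge_between_def by metis+
  obtain K L i where KL: "K \<in> M" "L \<in> M" "\<sigma> = face True i K" "\<sigma> = face False i L"
    using int_edge_cells[OF \<sigma>] .
  have e: "face True i K = face False i L" using KL by simp
  have ce: "{A \<in> M. \<sigma> \<in> cell_edges A} = {K, L}"
    using cells_of_internal_edge(1)[OF KL(1,2) e] KL(3) by simp
  moreover have "near \<sigma> \<in> {A \<in> M. \<sigma> \<in> cell_edges A}" "far \<sigma> \<in> {A \<in> M. \<sigma> \<in> cell_edges A}"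
    using nf c by blast+
  ultimately show ce': "{A \<in> M. \<sigma> \<in> cell_edges A} = {near \<sigma>, far \<sigma>}"
    using nf(3) by auto
  have "{K, L} = {near \<sigma>, far \<sigma>}"
    using ce ce' by simp
  then have cases: "near \<sigma> = K \<and> far \<sigma> = L \<or> near \<sigma> = L \<and> far \<sigma> = K"
    by (auto simp: doubleton_eq_iff)
  note s = cell_solid[OF KL(1)] cell_solid[OF KL(2)]
  have dir: "edge_dir \<sigma> = i"
    using edge_dir_face[OF s(1), of True i] KL(3) by simp
  have n: "axis i 1 \<bullet> outer_normal \<sigma> K = 1" "axis i 1 \<bullet> outer_normal \<sigma> L = -1"
    using outer_normal_face[OF s(1), of True i] outer_normal_face[OF s(2), of False i] KL(3,4)
    by (simp_all add: inner_axis_axis)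
  show "orient \<sigma> = 1 \<or> orient \<sigma> = -1" "axis (edge_dir \<sigma>) 1 \<bullet> outer_normal \<sigma> (far \<sigma>) = - orient \<sigma>"
    using cases n dir by (auto simp: orient_def)
  have h: "vol (half_cell (face b j A) A) > 0" if "A \<in> M" for b j A
  proof -
    note sA = cell_solid[OF that]
    have "solid_box (half_cell (face b j A) A)"
      unfolding half_cell_face[OF sA] using solid_box_mid[OF sA, of j] solid_boxD(2)[OF sA]
      by (auto intro!: solid_box_cbox)
    then show ?thesis by (rule solid_box_vol_pos)
  qed
  have "vol (half_cell \<sigma> K) > 0" "vol (half_cell \<sigma> L) > 0"
    using h[OF KL(1), of True i] h[OF KL(2), of False i] KL(3,4) by simp_all
  then show "vol (half_cell \<sigma> (near \<sigma>)) > 0" "vol (half_cell \<sigma> (far \<sigma>)) > 0"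
    using cases by auto
  show "D \<sigma> > 0"
    using solid_box_vol_pos dual_cell_bounds(1)[OF KL(1,3)] by blast
  show "area \<sigma> > 0"
    using solid_box_area_pos[OF s(1), of True i] KL(3) by simp
qed

lemma sum_directions: "(\<Sum>i\<in>UNIV. \<Sum>\<sigma>\<in>int_edges_dir \<Omega> M i. f \<sigma>) = (\<Sum>\<sigma>\<in>E. f \<sigma>)"
proof -
  have "E = (\<Union>i. int_edges_dir \<Omega> M i)"
    by (auto simp: int_edges_dir_def int_edges_def grid_edges_def)
  moreover have "int_edges_dir \<Omega> M i \<inter> int_edges_dir \<Omega> M j = {}" if "i \<noteq> j" for i j
    using that face_direction_unique by (fastforce simp: int_edges_dir_def grid_edges_dir_faces)
  moreover have "finite (int_edges_dir \<Omega> M i)" for i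
    by (rule finite_subset[OF _ finite_edges(2)]) (auto simp: int_edges_dir_def)
  ultimately show ?thesis
    by (simp add: sum.UNION_disjoint)
qed

lemma sum_cells_edges:
  assumes "\<And>\<sigma> K. \<sigma> \<in> ext_edges \<Omega> M \<Longrightarrow> f \<sigma> K = 0"
  shows "(\<Sum>K\<in>M. \<Sum>\<sigma>\<in>cell_edges K. f \<sigma> K) = (\<Sum>\<sigma>\<in>E. f \<sigma> (near \<sigma>) + f \<sigma> (far \<sigma>))"
proof -
  have "(\<Sum>K\<in>M. \<Sum>\<sigma>\<in>cell_edges K. f \<sigma> K) = (\<Sum>K\<in>M. \<Sum>\<sigma>\<in>{\<sigma> \<in> E. \<sigma> \<in> cell_edges K}. f \<sigma> K)"
  proof (rule sum.cong[OF refl])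
    fix K assume "K \<in> M"
    then show "(\<Sum>\<sigma>\<in>cell_edges K. f \<sigma> K) = (\<Sum>\<sigma>\<in>{\<sigma> \<in> E. \<sigma> \<in> cell_edges K}. f \<sigma> K)"
    proof (intro sum.mono_neutral_right)
      show "\<forall>\<sigma>\<in>cell_edges K - {\<sigma> \<in> E. \<sigma> \<in> cell_edges K}. f \<sigma> K = 0"
        using assms cell_edges_subset[OF \<open>K \<in> M\<close>] unfolding grid_edges_Un(1) by blast
    qed auto
  qed
  also have "\<dots> = (\<Sum>\<sigma>\<in>E. \<Sum>K\<in>{K \<in> M. \<sigma> \<in> cell_edges K}. f \<sigma> K)"
    by (rule sum.swap_restrict) simp_all
  also have "\<dots> = (\<Sum>\<sigma>\<in>E. f \<sigma> (near \<sigma>) + f \<sigma> (far \<sigma>))"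
    by (rule sum.cong) (simp_all add: adjacent(3,4))
  finally show ?thesis .
qed

lemma edge_deriv_eq: "\<sigma> \<in> E \<Longrightarrow> grad q \<sigma> = area \<sigma> / D \<sigma> * (q (far \<sigma>) - q (near \<sigma>)) * orient \<sigma>"
  by (simp add: edge_deriv_def case_prod_beta orient_def)

lemma edge_deriv_ext: "\<sigma> \<in> ext_edges \<Omega> M \<Longrightarrow> grad q \<sigma> = 0"
  using grid_edges_Un(2) by (auto simp: edge_deriv_def)

text \<open>Summation by parts: each internal edge is seen once from either side, with opposite normals.\<close>

lemma div_grad_duality:
  assumes "\<And>\<sigma>. \<sigma> \<in> ext_edges \<Omega> M \<Longrightarrow> w \<sigma> = 0"
  shows "(\<Sum>K\<in>M. q K * (\<Sum>\<sigma>\<in>cell_edges K. area \<sigma> * normal_value w \<sigma> K)) = - (\<Sum>\<sigma>\<in>E. D \<sigma> * w \<sigma> * grad q \<sigma>)"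
proof -
  have "(\<Sum>K\<in>M. q K * (\<Sum>\<sigma>\<in>cell_edges K. area \<sigma> * normal_value w \<sigma> K))
    = (\<Sum>K\<in>M. \<Sum>\<sigma>\<in>cell_edges K. q K * (area \<sigma> * normal_value w \<sigma> K))"
    by (simp add: sum_distrib_left)
  also have "\<dots> = (\<Sum>\<sigma>\<in>E. q (near \<sigma>) * (area \<sigma> * normal_value w \<sigma> (near \<sigma>)) +
      q (far \<sigma>) * (area \<sigma> * normal_value w \<sigma> (far \<sigma>)))"
    by (rule sum_cells_edges) (simp add: normal_value_def assms)
  also have "\<dots> = (\<Sum>\<sigma>\<in>E. - (D \<sigma> * w \<sigma> * grad q \<sigma>))"
  proof (rule sum.cong)
    fix \<sigma> assume \<sigma>: "\<sigma> \<in> E"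
    show "q (near \<sigma>) * (area \<sigma> * normal_value w \<sigma> (near \<sigma>)) +
      q (far \<sigma>) * (area \<sigma> * normal_value w \<sigma> (far \<sigma>)) = - (D \<sigma> * w \<sigma> * grad q \<sigma>)"
      using adjacent(9)[OF \<sigma>]
      by (simp add: normal_value_def adjacent(6)[OF \<sigma>] orient_def[symmetric] edge_deriv_eq[OF \<sigma>] field_simps)
  qed simp
  finally show ?thesis by (simp add: sum_negf)
qed

lemma dual_average_pos:
  assumes "\<sigma> \<in> E" "\<And>K. K \<in> M \<Longrightarrow> q K > 0"
  shows "avg q \<sigma> > 0"
  using adjacent[OF assms(1)] assms(2)
  by (auto simp: dual_average_def case_prod_beta intro!: divide_pos_pos add_pos_pos mult_pos_pos)

lemma mass_flux_eq:
  "mass_flux \<Omega> M r v Q \<sigma> K =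
    area \<sigma> * normal_value (\<lambda>\<sigma>. if \<sigma> \<in> E then edge_density \<Omega> M r \<sigma> * v \<sigma> - Q \<sigma> else 0) \<sigma> K"
  by (simp add: mass_flux_def normal_value_def algebra_simps)

lemma conservative_mass_flux: "conservative_flux \<Omega> M (mass_flux \<Omega> M r v Q)"
proof -
  have "mass_flux \<Omega> M r v Q \<sigma> K = - mass_flux \<Omega> M r v Q \<sigma> L" if eb: "edge_between \<Omega> M \<sigma> K L" for \<sigma> K L
  proof -
    have \<sigma>: "\<sigma> \<in> E" and KL: "K \<in> M" "L \<in> M" "K \<noteq> L"
      using eb unfolding edge_between_def by blast+
    have "\<sigma> \<in> cell_edges K" "\<sigma> \<in> cell_edges L"
      using eb unfolding edge_between_def by metis+
    then have "K \<in> {near \<sigma>, far \<sigma>}" "L \<in> {near \<sigma>, far \<sigma>}"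
      using KL unfolding adjacent(4)[OF \<sigma>, symmetric] by blast+
    then have "normal_value f \<sigma> K = - normal_value f \<sigma> L" for f
      using KL(3) adjacent(6)[OF \<sigma>] by (auto simp: normal_value_def orient_def)
    then show ?thesis
      using \<sigma> by (simp add: mass_flux_def algebra_simps)
  qed
  moreover have "mass_flux \<Omega> M r v Q \<sigma> K = 0" if "\<sigma> \<in> ext_edges \<Omega> M" for \<sigma> K
    using that grid_edges_Un(2) by (auto simp: mass_flux_def)
  ultimately show ?thesis
    unfolding conservative_flux_def by blast
qed

section \<open>The global estimates\<close>

text \<open>
  Sending \<open>(\<sigma>, \<epsilon>)\<close> to \<open>(\<sigma>', \<epsilon>)\<close>, where \<open>\<sigma>'\<close> is the neighbour across \<open>\<epsilon>\<close>, is an involution of the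
  pairs with internal \<open>\<sigma>'\<close>.  It changes the sign of the mass flux and keeps the upwind velocity, so
  these pairs contribute nothing.  On the other pairs, outflow counts positively and inflow carries
  the velocity \<open>0\<close> of an external edge.
\<close>

lemma upwind_energy_flux_nonneg:
  assumes cons: "\<And>\<epsilon> \<sigma> \<sigma>'. \<lbrakk>\<sigma> \<in> E; \<sigma>' \<in> E; dual_edge_between M \<epsilon> \<sigma> \<sigma>'\<rbrakk> \<Longrightarrow> G \<epsilon> \<sigma> = - G \<epsilon> \<sigma>'"
    and bdry: "\<And>\<epsilon> \<sigma>. \<epsilon> \<subseteq> frontier \<Omega> \<Longrightarrow> G \<epsilon> \<sigma> = 0"
    and v: "vanishes_ext \<Omega> M v"
  shows "(\<Sum>\<sigma>\<in>E. \<Sum>\<epsilon>\<in>cell_edges (dual_cell M \<sigma>). G \<epsilon> \<sigma> * (upwind M G v \<epsilon> \<sigma>)^2) \<ge> 0"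
proof -
  define S where "S = Sigma E (\<lambda>\<sigma>. cell_edges (dual_cell M \<sigma>))"
  define nb where "nb = (\<lambda>(\<sigma>, \<epsilon>). (THE \<sigma>'. dual_edge_between M \<epsilon> \<sigma> \<sigma>', \<epsilon>))"
  define t where "t = (\<lambda>(\<sigma>, \<epsilon>). G \<epsilon> \<sigma> * (upwind M G v \<epsilon> \<sigma>)^2)"
  define I where "I = {(\<sigma>, \<epsilon>) \<in> S. \<exists>\<sigma>'\<in>E. dual_edge_between M \<epsilon> \<sigma> \<sigma>'}"
  have finS: "finite S" unfolding S_def by simp
  have the: "(THE \<sigma>'. dual_edge_between M \<epsilon> \<sigma> \<sigma>') = \<sigma>'"
    if "\<sigma> \<in> E" "dual_edge_between M \<epsilon> \<sigma> \<sigma>'" for \<epsilon> \<sigma> \<sigma>'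
  proof (rule the_equality, rule that(2))
    have "\<epsilon> \<in> cell_edges (dual_cell M \<sigma>)" using that(2) by (simp add: dual_edge_between_def)
    then show "\<tau> = \<sigma>'" if "dual_edge_between M \<epsilon> \<sigma> \<tau>" for \<tau>
      using dual_neighbour_unique[OF \<open>\<sigma> \<in> E\<close> _ that \<open>dual_edge_between M \<epsilon> \<sigma> \<sigma>'\<close>] by blast
  qed
  have I: "nb x \<in> I \<and> nb (nb x) = x \<and> t (nb x) = - t x" if x: "x \<in> I" for x
  proof -
    obtain \<sigma> \<epsilon> \<sigma>' where h: "x = (\<sigma>, \<epsilon>)" "\<sigma> \<in> E" "\<sigma>' \<in> E" "dual_edge_between M \<epsilon> \<sigma> \<sigma>'"
      using x by (auto simp: I_def S_def)
    have h': "dual_edge_between M \<epsilon> \<sigma>' \<sigma>"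
      using dual_edge_between_sym[OF h(2-4)] .
    have n: "nb (\<sigma>, \<epsilon>) = (\<sigma>', \<epsilon>)" "nb (\<sigma>', \<epsilon>) = (\<sigma>, \<epsilon>)"
      using the[OF h(2,4)] the[OF h(3) h'] by (simp_all add: nb_def)
    have "(\<sigma>', \<epsilon>) \<in> I"
      using h h' by (auto simp: I_def S_def dual_edge_between_def)
    moreover have "t (\<sigma>', \<epsilon>) = - t (\<sigma>, \<epsilon>)"
      using cons[OF h(2-4)] the[OF h(2,4)] the[OF h(3) h']
      by (cases "G \<epsilon> \<sigma>" "0::real" rule: linorder_cases) (auto simp: t_def upwind_def)
    ultimately show ?thesis using n h(1) by simp
  qed
  have "sum t I = sum (\<lambda>x. t (nb x)) I"
    by (rule sum.reindex_bij_witness[of _ nb nb]) (use I in auto)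
  also have "\<dots> = - sum t I"
    using I by (simp add: sum_negf)
  finally have I0: "sum t I = 0" by simp
  have "t x \<ge> 0" if x: "x \<in> S - I" for x
  proof -
    obtain \<sigma> \<epsilon> where h: "x = (\<sigma>, \<epsilon>)" "\<sigma> \<in> E" "\<epsilon> \<in> cell_edges (dual_cell M \<sigma>)"
      and n: "\<And>\<sigma>'. dual_edge_between M \<epsilon> \<sigma> \<sigma>' \<Longrightarrow> \<sigma>' \<notin> E"
      using x by (auto simp: I_def S_def)
    show ?thesis
    proof (cases "G \<epsilon> \<sigma> \<ge> 0")
      case True
      then show ?thesis by (simp add: t_def h)
    next
      case False
      then have "\<not> \<epsilon> \<subseteq> frontier \<Omega>" using bdry by fastforce
      then obtain \<sigma>' where \<sigma>': "dual_edge_between M \<epsilon> \<sigma> \<sigma>'"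
        using dual_neighbour_exists[OF h(2,3)] by blast
      then have "\<sigma>' \<in> grid_edges M"
        by (auto simp: dual_edge_between_def grid_edges_def)
      then have "v \<sigma>' = 0"
        using n[OF \<sigma>'] grid_edges_Un(1) v by (auto simp: vanishes_ext_def)
      then show ?thesis
        using the[OF h(2) \<sigma>'] False by (simp add: t_def h upwind_def)
    qed
  qed
  then have "sum t (S - I) \<ge> 0" by (rule sum_nonneg)
  moreover have "sum t S = sum t (S - I) + sum t I"
    by (rule sum.subset_diff[OF _ finS]) (auto simp: I_def)
  ultimately have "sum t S \<ge> 0" using I0 by simp
  then show ?thesis
    by (simp add: S_def t_def sum.Sigma)
qed

text \<open>
  By \<open>(a - b)\<^sup>2 \<le> 2 (a\<^sup>2 + b\<^sup>2)\<close> the contribution of an edge splits between its two cells.  The factor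
  \<open>|\<partial>K| / |K|\<close> in \<open>\<alpha>\<close> gives each edge of \<open>K\<close> a share of \<open>|K| q\<^sub>K\<^sup>2 / \<delta>t\<close> proportional to its
  area, and the shares add up to at most the whole.
\<close>

lemma stabilisation_absorbed:
  assumes dt: "dt > 0" and r': "\<And>K. K \<in> M \<Longrightarrow> r' K > 0"
    and cfl: "cfl_condition \<Omega> M dt r' G"
  shows "(\<Sum>\<sigma>\<in>E. 2 * dt * D \<sigma> * (grad q \<sigma>)^2 / avg r' \<sigma>) \<le> (\<Sum>K\<in>M. vol K / dt * (q K)^2)"
proof -
  define b where "b \<sigma> = 4 * dt * (area \<sigma>)^2 / (D \<sigma> * avg r' \<sigma>)" for \<sigma>
  have "2 * dt * D \<sigma> * (grad q \<sigma>)^2 / avg r' \<sigma> \<le> b \<sigma> * (q (near \<sigma>))^2 + b \<sigma> * (q (far \<sigma>))^2"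
    if \<sigma>: "\<sigma> \<in> E" for \<sigma>
  proof -
    have r0: "avg r' \<sigma> > 0" using dual_average_pos[OF \<sigma>] r' by blast
    note D0 = adjacent(9)[OF \<sigma>]
    have "(orient \<sigma>)^2 = 1" using adjacent(5)[OF \<sigma>] by auto
    then have "(grad q \<sigma>)^2 = (area \<sigma> / D \<sigma>)^2 * (q (far \<sigma>) - q (near \<sigma>))^2"
      by (simp add: edge_deriv_eq[OF \<sigma>] power_mult_distrib power_divide)
    also have "\<dots> \<le> (area \<sigma> / D \<sigma>)^2 * (2 * ((q (near \<sigma>))^2 + (q (far \<sigma>))^2))"
    proof (rule mult_left_mono)
      have "2 * ((q (near \<sigma>))^2 + (q (far \<sigma>))^2) - (q (far \<sigma>) - q (near \<sigma>))^2 = (q (far \<sigma>) + q (near \<sigma>))^2"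
        by (simp add: power2_eq_square algebra_simps)
      then show "(q (far \<sigma>) - q (near \<sigma>))^2 \<le> 2 * ((q (near \<sigma>))^2 + (q (far \<sigma>))^2)"
        by (metis diff_ge_0_iff_ge zero_le_power2)
    qed simp
    finally have "2 * dt * D \<sigma> / avg r' \<sigma> * (grad q \<sigma>)^2 \<le>
        2 * dt * D \<sigma> / avg r' \<sigma> * ((area \<sigma> / D \<sigma>)^2 * (2 * ((q (near \<sigma>))^2 + (q (far \<sigma>))^2)))"
      using dt r0 D0 by (intro mult_left_mono) auto
    also have "\<dots> = b \<sigma> * (q (near \<sigma>))^2 + b \<sigma> * (q (far \<sigma>))^2"
      using dt r0 D0 by (simp add: b_def field_simps power2_eq_square)
    finally show ?thesis by simp
  qed
  then have "(\<Sum>\<sigma>\<in>E. 2 * dt * D \<sigma> * (grad q \<sigma>)^2 / avg r' \<sigma>) \<le>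
      (\<Sum>\<sigma>\<in>E. (if \<sigma> \<in> E then b \<sigma> * (q (near \<sigma>))^2 else 0) + (if \<sigma> \<in> E then b \<sigma> * (q (far \<sigma>))^2 else 0))"
    by (intro sum_mono) simp
  also have "\<dots> = (\<Sum>K\<in>M. \<Sum>\<sigma>\<in>cell_edges K. if \<sigma> \<in> E then b \<sigma> * (q K)^2 else 0)"
    by (rule sum_cells_edges[symmetric]) (use grid_edges_Un(2) in auto)
  also have "\<dots> \<le> (\<Sum>K\<in>M. vol K / dt * (q K)^2)"
  proof (rule sum_mono)
    fix K assume K: "K \<in> M"
    note s = cell_solid[OF K]
    have a0: "area \<sigma> > 0" if "\<sigma> \<in> cell_edges K" for \<sigma>
      using that solid_box_area_pos[OF s] by (auto simp: cell_edges_faces)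
    have p0: "perimeter K > 0"
      unfolding perimeter_def by (rule sum_pos) (simp_all add: a0 cell_edges_nonempty)
    have v0: "vol K > 0" using solid_box_vol_pos[OF s] .
    have "(if \<sigma> \<in> E then b \<sigma> * (q K)^2 else 0) \<le> area \<sigma> * (vol K / (dt * perimeter K) * (q K)^2)"
      if c: "\<sigma> \<in> cell_edges K" for \<sigma>
    proof (cases "\<sigma> \<in> E")
      case True
      have r0: "avg r' \<sigma> > 0" using dual_average_pos[OF True] r' by blast
      note D0 = adjacent(9)[OF True] and a0 = a0[OF c]
      let ?\<alpha> = "alpha \<Omega> M r' K \<sigma>"
      have \<alpha>: "?\<alpha> > 0"
        using r0 D0 a0 p0 v0 by (simp add: alpha_def)
      have "dt \<le> 1 / 2 * sqrt (1 / ?\<alpha>)"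
        using cfl K c True by (simp add: cfl_condition_def Let_def)
      then have "(2 * dt)^2 \<le> (sqrt (1 / ?\<alpha>))^2"
        using dt by (intro power_mono) auto
      then have "4 * dt^2 * ?\<alpha> \<le> 1"
        using \<alpha> by (simp add: field_simps)
      then have "4 * dt^2 * ?\<alpha> * (vol K * area \<sigma> / (dt * perimeter K)) \<le> 1 * (vol K * area \<sigma> / (dt * perimeter K))"
        using dt p0 v0 a0 by (intro mult_right_mono) auto
      also have "4 * dt^2 * ?\<alpha> * (vol K * area \<sigma> / (dt * perimeter K)) = b \<sigma>"
        using dt p0 v0 r0 D0 by (simp add: alpha_def b_def field_simps power2_eq_square)
      finally have "b \<sigma> * (q K)^2 \<le> vol K * area \<sigma> / (dt * perimeter K) * (q K)^2"
        by (intro mult_right_mono) auto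
      then show ?thesis using True by (simp add: mult_ac)
    next
      case False
      then show ?thesis using a0[OF c] p0 v0 dt by simp
    qed
    then have "(\<Sum>\<sigma>\<in>cell_edges K. if \<sigma> \<in> E then b \<sigma> * (q K)^2 else 0) \<le>
        (\<Sum>\<sigma>\<in>cell_edges K. area \<sigma> * (vol K / (dt * perimeter K) * (q K)^2))"
      by (rule sum_mono)
    also have "\<dots> = perimeter K * (vol K / (dt * perimeter K) * (q K)^2)"
      unfolding perimeter_def by (simp only: sum_distrib_right)
    also have "\<dots> = vol K / dt * (q K)^2"
      using p0 by simp
    finally show "(\<Sum>\<sigma>\<in>cell_edges K. if \<sigma> \<in> E then b \<sigma> * (q K)^2 else 0) \<le> vol K / dt * (q K)^2" .
  qed
  finally show ?thesis .
qed

lemma laplacian_duality: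
  "(\<Sum>K\<in>M. vol K * (q K * cell_laplacian \<Omega> M p K)) = - (\<Sum>\<sigma>\<in>E. D \<sigma> * grad p \<sigma> * grad q \<sigma>)"
proof -
  have "vol K * (q K * cell_laplacian \<Omega> M p K) = q K * (\<Sum>\<sigma>\<in>cell_edges K. area \<sigma> * normal_value (grad p) \<sigma> K)"
    if "K \<in> M" for K
    using solid_box_vol_pos[OF cell_solid[OF that]] by (simp add: cell_laplacian_def cell_div_def)
  then have "(\<Sum>K\<in>M. vol K * (q K * cell_laplacian \<Omega> M p K)) =
      (\<Sum>K\<in>M. q K * (\<Sum>\<sigma>\<in>cell_edges K. area \<sigma> * normal_value (grad p) \<sigma> K))"
    by (rule sum.cong[OF refl])
  then show ?thesis
    using div_grad_duality[of "grad p" q] by (simp add: edge_deriv_ext)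
qed

text \<open>
  By the Poisson equation the density increment is that of \<open>e\<^sup>\<phi> - \<epsilon>\<^sup>2 \<Delta>\<phi>\<close>.  It is multiplied by the new
  potential, so both parts bound the energy increment from above: the first by convexity, the second,
  after summation by parts, by \<open>a (a - b) \<ge> (a\<^sup>2 - b\<^sup>2) / 2\<close>.
\<close>

lemma potential_energy_estimate:
  assumes dt: "dt > 0"
    and p: "poisson_boltzmann \<Omega> M eps r p" and p': "poisson_boltzmann \<Omega> M eps r' p'"
  shows "(\<Sum>K\<in>M. vol K / dt * (exp (p' K) * (p' K - 1) - exp (p K) * (p K - 1)))
    + eps^2 / 2 * (\<Sum>\<sigma>\<in>E. D \<sigma> / dt * ((grad p' \<sigma>)^2 - (grad p \<sigma>)^2))
    \<le> (\<Sum>K\<in>M. vol K / dt * (p' K * (r' K - r K)))"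
proof -
  have v0: "vol K > 0" if "K \<in> M" for K using solid_box_vol_pos[OF cell_solid[OF that]] .
  have "(\<Sum>K\<in>M. vol K / dt * (exp (p' K) * (p' K - 1) - exp (p K) * (p K - 1)))
    \<le> (\<Sum>K\<in>M. vol K / dt * (p' K * (exp (p' K) - exp (p K))))"
    using dt v0 by (intro sum_mono mult_left_mono exp_energy_convex) (auto simp: less_imp_le)
  also have "\<dots> = (\<Sum>K\<in>M. vol K / dt * (p' K * (r' K - r K))
      + eps^2 / dt * (vol K * (p' K * cell_laplacian \<Omega> M p' K)) - eps^2 / dt * (vol K * (p' K * cell_laplacian \<Omega> M p K)))"
  proof (rule sum.cong)
    fix K assume K: "K \<in> M"
    have "exp (p' K) = r' K + eps^2 * cell_laplacian \<Omega> M p' K" "exp (p K) = r K + eps^2 * cell_laplacian \<Omega> M p K"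
      using p p' K by (auto simp: poisson_boltzmann_def algebra_simps)
    then show "vol K / dt * (p' K * (exp (p' K) - exp (p K))) = vol K / dt * (p' K * (r' K - r K))
      + eps^2 / dt * (vol K * (p' K * cell_laplacian \<Omega> M p' K)) - eps^2 / dt * (vol K * (p' K * cell_laplacian \<Omega> M p K))"
      using dt by (simp add: field_simps)
  qed simp
  also have "\<dots> = (\<Sum>K\<in>M. vol K / dt * (p' K * (r' K - r K)))
      - eps^2 / dt * (\<Sum>\<sigma>\<in>E. D \<sigma> * grad p' \<sigma> * grad p' \<sigma>) + eps^2 / dt * (\<Sum>\<sigma>\<in>E. D \<sigma> * grad p \<sigma> * grad p' \<sigma>)"
    unfolding sum.distrib sum_subtractf sum_distrib_left[symmetric] laplacian_duality by simp
  also have "\<dots> \<le> (\<Sum>K\<in>M. vol K / dt * (p' K * (r' K - r K)))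
      - eps^2 / 2 * (\<Sum>\<sigma>\<in>E. D \<sigma> / dt * ((grad p' \<sigma>)^2 - (grad p \<sigma>)^2))"
  proof -
    have "(\<Sum>\<sigma>\<in>E. D \<sigma> / dt * ((grad p' \<sigma>)^2 - (grad p \<sigma>)^2) / 2) \<le>
        (\<Sum>\<sigma>\<in>E. D \<sigma> / dt * (grad p' \<sigma> * grad p' \<sigma> - grad p \<sigma> * grad p' \<sigma>))"
    proof (rule sum_mono)
      fix \<sigma> assume "\<sigma> \<in> E"
      have "0 \<le> (grad p' \<sigma> - grad p \<sigma>)^2" by simp
      then have "((grad p' \<sigma>)^2 - (grad p \<sigma>)^2) / 2 \<le> grad p' \<sigma> * grad p' \<sigma> - grad p \<sigma> * grad p' \<sigma>"
        by (simp add: power2_eq_square field_simps)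
      then have "D \<sigma> / dt * (((grad p' \<sigma>)^2 - (grad p \<sigma>)^2) / 2) \<le> D \<sigma> / dt * (grad p' \<sigma> * grad p' \<sigma> - grad p \<sigma> * grad p' \<sigma>)"
        using dt adjacent(9)[OF \<open>\<sigma> \<in> E\<close>] by (intro mult_left_mono) auto
      then show "D \<sigma> / dt * ((grad p' \<sigma>)^2 - (grad p \<sigma>)^2) / 2 \<le> D \<sigma> / dt * (grad p' \<sigma> * grad p' \<sigma> - grad p \<sigma> * grad p' \<sigma>)"
        by simp
    qed
    then have "eps^2 * ((\<Sum>\<sigma>\<in>E. D \<sigma> / dt * ((grad p' \<sigma>)^2 - (grad p \<sigma>)^2)) / 2) \<le>
        eps^2 * (\<Sum>\<sigma>\<in>E. D \<sigma> / dt * (grad p' \<sigma> * grad p' \<sigma> - grad p \<sigma> * grad p' \<sigma>))"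
      by (intro mult_left_mono) (simp_all add: sum_divide_distrib)
    also have "\<dots> = eps^2 / dt * (\<Sum>\<sigma>\<in>E. D \<sigma> * grad p' \<sigma> * grad p' \<sigma>) - eps^2 / dt * (\<Sum>\<sigma>\<in>E. D \<sigma> * grad p \<sigma> * grad p' \<sigma>)"
      by (simp add: sum_distrib_left sum_subtractf algebra_simps)
    finally show ?thesis by simp
  qed
  finally show ?thesis by simp
qed

end

theorem theorem4p4:
  fixes \<Omega> :: "(real ^ 'd::finite) set" and M :: "'d cell set"
    and c :: "'d edge \<Rightarrow> 'd edge \<Rightarrow> 'd edge \<Rightarrow> 'd cell \<Rightarrow> real"
    and T dt eps eta :: real and N n :: nat
    and rho0 phi0 :: "real ^ 'd \<Rightarrow> real" and u0 :: "real ^ 'd \<Rightarrow> real ^ 'd"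
    and rho phi Lam :: "nat \<Rightarrow> 'd cell \<Rightarrow> real" and u Q :: "nat \<Rightarrow> 'd edge \<Rightarrow> real"
  assumes dim: "CARD('d) \<le> 3"
    and grid: "mac_grid \<Omega> M"
    and coeffs: "dual_flux_coeffs \<Omega> M c"
    and time: "dt > 0" "T = real N * dt"
    and eps: "0 < eps" "eps \<le> 1"
    and data: "set_integrable lebesgue \<Omega> rho0" "set_integrable lebesgue \<Omega> u0"
      "set_integrable lebesgue \<Omega> phi0"
    and init: "initialised \<Omega> M rho0 u0 phi0 (rho 0) (u 0) (phi 0)"
    and sol: "scheme_solution \<Omega> M c dt N eps rho u phi Q Lam"
    and n: "n < N"
    and init_poisson: "n = 0 \<Longrightarrow> poisson_boltzmann \<Omega> M eps (rho 0) (phi 0)"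
    and cfl: "cfl_condition \<Omega> M dt (rho (Suc n))
      (dual_flux \<Omega> M c (mass_flux \<Omega> M (rho n) (u n) (Q (Suc n))))"
    and Q: "\<And>i \<sigma>. \<sigma> \<in> int_edges_dir \<Omega> M i \<Longrightarrow>
      Q (Suc n) \<sigma> = eta * dt * edge_deriv \<Omega> M (phi (Suc n)) \<sigma>"
    and Lam: "\<And>K. K \<in> M \<Longrightarrow>
      Lam n K = dt / vol K * (\<Sum>\<sigma>\<in>cell_edges K. area \<sigma> * normal_value (u n) \<sigma> K)"
    and eta: "\<And>i \<sigma>. \<sigma> \<in> int_edges_dir \<Omega> M i \<Longrightarrow>
      eta \<ge> (edge_density \<Omega> M (rho n) \<sigma>)^2 / dual_average \<Omega> M (rho (Suc n)) \<sigma>"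
  shows
    "(\<Sum>i\<in>UNIV. \<Sum>\<sigma>\<in>int_edges_dir \<Omega> M i.
        1 / 2 * (vol (dual_cell M \<sigma>) / dt) *
        (dual_average \<Omega> M (rho (Suc n)) \<sigma> * (u (Suc n) \<sigma>)^2
         - dual_average \<Omega> M (rho n) \<sigma> * (u n \<sigma>)^2))
     + (\<Sum>K\<in>M. vol K / dt *
        (exp (phi (Suc n) K) * (phi (Suc n) K - 1) - exp (phi n K) * (phi n K - 1)))
     + eps^2 / 2 * (\<Sum>i\<in>UNIV. \<Sum>\<sigma>\<in>int_edges_dir \<Omega> M i.
        vol (dual_cell M \<sigma>) / dt *
        (\<bar>edge_deriv \<Omega> M (phi (Suc n)) \<sigma>\<bar>^2 - \<bar>edge_deriv \<Omega> M (phi n) \<sigma>\<bar>^2))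
     \<le> 0"
proof -
  interpret conforming_grid \<Omega> M by unfold_locales (rule grid)
  define F where "F = mass_flux \<Omega> M (rho n) (u n) (Q (Suc n))"
  define G where "G = dual_flux \<Omega> M c F"
  define R where "R \<sigma> = edge_density \<Omega> M (rho n) \<sigma>" for \<sigma>
  let ?r = "rho n" and ?r' = "rho (Suc n)" and ?v = "u n" and ?v' = "u (Suc n)"
    and ?p = "phi n" and ?p' = "phi (Suc n)"
  have rpos: "rho m K > 0" if "m \<le> N" "K \<in> M" for m K
    using sol that by (auto simp: scheme_solution_def)
  have r'pos: "?r' K > 0" if "K \<in> M" for K using rpos that n by simp
  have vext: "vanishes_ext \<Omega> M ?v"
    using sol n by (auto simp: scheme_solution_def)
  have step: "mass_balance M dt (rho m) (rho (Suc m)) (mass_flux \<Omega> M (rho m) (u m) (Q (Suc m)))"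
    "momentum_balance \<Omega> M dt (rho m) (rho (Suc m)) (u m) (u (Suc m)) (phi (Suc m)) (Lam m)
      (dual_flux \<Omega> M c (mass_flux \<Omega> M (rho m) (u m) (Q (Suc m))))"
    "poisson_boltzmann \<Omega> M eps (rho (Suc m)) (phi (Suc m))" if "m < N" for m
    using sol that by (auto simp: scheme_solution_def Let_def)
  have mass: "mass_balance M dt ?r ?r' F" and mom: "momentum_balance \<Omega> M dt ?r ?r' ?v ?v' ?p' (Lam n) G"
    and poisson': "poisson_boltzmann \<Omega> M eps ?r' ?p'"
    using step[OF n] by (simp_all add: F_def G_def)
  have poisson: "poisson_boltzmann \<Omega> M eps ?r ?p"
    using init_poisson step(3)[of "n - 1"] n by (cases n) auto
  have Fcons: "conservative_flux \<Omega> M F"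
    unfolding F_def by (rule conservative_mass_flux)
  have Gcons: "G \<epsilon> \<sigma> = - G \<epsilon> \<sigma>'" if "\<sigma> \<in> E" "\<sigma>' \<in> E" "dual_edge_between M \<epsilon> \<sigma> \<sigma>'" for \<epsilon> \<sigma> \<sigma>'
    using coeffs Fcons that unfolding dual_flux_coeffs_def G_def by blast
  have dual_mass: "dual_mass_balance \<Omega> M dt ?r ?r' G"
    using coeffs Fcons mass time(1) unfolding dual_flux_coeffs_def G_def by blast
  have dirE: "\<exists>i. \<sigma> \<in> int_edges_dir \<Omega> M i" if "\<sigma> \<in> E" for \<sigma>
    using that by (auto simp: int_edges_dir_def int_edges_def grid_edges_def)
  have QE: "Q (Suc n) \<sigma> = eta * dt * grad ?p' \<sigma>" if "\<sigma> \<in> E" for \<sigma>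
    using dirE[OF that] Q by blast

  \<comment> \<open>Kinetic energy: the local estimates, summed over all internal edges.\<close>
  define kin where "kin \<sigma> = 1 / 2 * (D \<sigma> / dt) * (avg ?r' \<sigma> * (?v' \<sigma>)^2 - avg ?r \<sigma> * (?v \<sigma>)^2)" for \<sigma>
  define up where "up \<sigma> = (\<Sum>\<epsilon>\<in>cell_edges (dual_cell M \<sigma>). G \<epsilon> \<sigma> * (upwind M G ?v \<epsilon> \<sigma>)^2)" for \<sigma>
  have "kin \<sigma> + 1 / 2 * up \<sigma> + D \<sigma> * R \<sigma> * ?v \<sigma> * grad ?p' \<sigma> \<le>
      D \<sigma> * ?v \<sigma> * grad (Lam n) \<sigma> + eta * dt * (D \<sigma> * (grad ?p' \<sigma>)^2)
      + 2 * dt * D \<sigma> * (grad (Lam n) \<sigma>)^2 / avg ?r' \<sigma>" if \<sigma>: "\<sigma> \<in> E" for \<sigma>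
    unfolding kin_def up_def
  proof (rule edge_kinetic_estimate)
    obtain i where i: "\<sigma> \<in> int_edges_dir \<Omega> M i" using dirE[OF \<sigma>] by blast
    show "avg ?r' \<sigma> > 0" using dual_average_pos[OF \<sigma>] r'pos by blast
    show "D \<sigma> > 0" using adjacent(9)[OF \<sigma>] .
    show "dt > 0" using time by simp
    show "1 / dt * (avg ?r' \<sigma> - avg ?r \<sigma>) + 1 / D \<sigma> * (\<Sum>\<epsilon>\<in>cell_edges (dual_cell M \<sigma>). G \<epsilon> \<sigma>) = 0"
      using dual_mass \<sigma> unfolding dual_mass_balance_def by blast
    show "1 / dt * (avg ?r' \<sigma> * ?v' \<sigma> - avg ?r \<sigma> * ?v \<sigma>) +
        1 / D \<sigma> * (\<Sum>\<epsilon>\<in>cell_edges (dual_cell M \<sigma>). G \<epsilon> \<sigma> * upwind M G ?v \<epsilon> \<sigma>)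
        = - R \<sigma> * grad ?p' \<sigma> + grad (Lam n) \<sigma>"
      using mom i unfolding momentum_balance_def R_def by blast
    show "upwind M G ?v \<epsilon> \<sigma> = ?v \<sigma>" if "G \<epsilon> \<sigma> \<ge> 0" for \<epsilon>
      using that by (simp add: upwind_def)
    show "R \<sigma> ^ 2 / avg ?r' \<sigma> \<le> eta"
      using eta[OF i] by (simp add: R_def)
    have "\<sigma> \<in> cell_edges (near \<sigma>)" "near \<sigma> \<in> M"
      using adjacent(1,4)[OF \<sigma>] by blast+
    then show "dt \<le> avg ?r' \<sigma> * D \<sigma> / (4 * (\<Sum>\<epsilon>\<in>cell_edges (dual_cell M \<sigma>). - neg_part (G \<epsilon> \<sigma>)))"
      if "(\<Sum>\<epsilon>\<in>cell_edges (dual_cell M \<sigma>). - neg_part (G \<epsilon> \<sigma>)) \<noteq> 0"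
      using cfl \<sigma> that unfolding cfl_condition_def Let_def F_def[symmetric] G_def[symmetric] by blast
  qed simp
  then have "(\<Sum>\<sigma>\<in>E. kin \<sigma> + 1 / 2 * up \<sigma> + D \<sigma> * R \<sigma> * ?v \<sigma> * grad ?p' \<sigma>) \<le>
      (\<Sum>\<sigma>\<in>E. D \<sigma> * ?v \<sigma> * grad (Lam n) \<sigma> + eta * dt * (D \<sigma> * (grad ?p' \<sigma>)^2)
      + 2 * dt * D \<sigma> * (grad (Lam n) \<sigma>)^2 / avg ?r' \<sigma>)"
    by (rule sum_mono)
  then have kinetic: "(\<Sum>\<sigma>\<in>E. kin \<sigma>) + 1 / 2 * (\<Sum>\<sigma>\<in>E. up \<sigma>) + (\<Sum>\<sigma>\<in>E. D \<sigma> * R \<sigma> * ?v \<sigma> * grad ?p' \<sigma>) \<le>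
      (\<Sum>\<sigma>\<in>E. D \<sigma> * ?v \<sigma> * grad (Lam n) \<sigma>) + eta * dt * (\<Sum>\<sigma>\<in>E. D \<sigma> * (grad ?p' \<sigma>)^2)
      + (\<Sum>\<sigma>\<in>E. 2 * dt * D \<sigma> * (grad (Lam n) \<sigma>)^2 / avg ?r' \<sigma>)"
    by (simp add: sum.distrib sum_distrib_left)

  have upwind: "(\<Sum>\<sigma>\<in>E. up \<sigma>) \<ge> 0"
    unfolding up_def
    by (rule upwind_energy_flux_nonneg) (use Gcons vext in \<open>auto simp: G_def dual_flux_def\<close>)

  have "- (\<Sum>\<sigma>\<in>E. D \<sigma> * ?v \<sigma> * grad (Lam n) \<sigma>) =
      (\<Sum>K\<in>M. Lam n K * (\<Sum>\<sigma>\<in>cell_edges K. area \<sigma> * normal_value ?v \<sigma> K))"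
    using div_grad_duality[of ?v "Lam n"] vext by (simp add: vanishes_ext_def)
  also have "\<dots> = (\<Sum>K\<in>M. vol K / dt * (Lam n K)^2)"
  proof (rule sum.cong)
    fix K assume K: "K \<in> M"
    have "(\<Sum>\<sigma>\<in>cell_edges K. area \<sigma> * normal_value ?v \<sigma> K) = vol K / dt * Lam n K"
      using Lam[OF K] time(1) solid_box_vol_pos[OF cell_solid[OF K]] by simp
    then show "Lam n K * (\<Sum>\<sigma>\<in>cell_edges K. area \<sigma> * normal_value ?v \<sigma> K) = vol K / dt * (Lam n K)^2"
      by (simp add: power2_eq_square)
  qed simp
  finally have Lam_work: "(\<Sum>\<sigma>\<in>E. D \<sigma> * ?v \<sigma> * grad (Lam n) \<sigma>) = - (\<Sum>K\<in>M. vol K / dt * (Lam n K)^2)"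
    by simp
  have Lam_abs: "(\<Sum>\<sigma>\<in>E. 2 * dt * D \<sigma> * (grad (Lam n) \<sigma>)^2 / avg ?r' \<sigma>) \<le> (\<Sum>K\<in>M. vol K / dt * (Lam n K)^2)"
    by (rule stabilisation_absorbed[OF time(1) r'pos cfl])

  \<comment> \<open>Electric work: the mass flux is the normal component of \<open>w\<close>, and testing the mass balance with
      the new potential produces the dissipation due to \<open>Q\<close>.\<close>
  define w where "w \<sigma> = (if \<sigma> \<in> E then R \<sigma> * ?v \<sigma> - Q (Suc n) \<sigma> else 0)" for \<sigma>
  have "(\<Sum>K\<in>M. vol K / dt * (?p' K * (?r' K - ?r K))) =
      - (\<Sum>K\<in>M. ?p' K * (\<Sum>\<sigma>\<in>cell_edges K. area \<sigma> * normal_value w \<sigma> K))"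
    unfolding sum_negf[symmetric]
  proof (rule sum.cong)
    fix K assume K: "K \<in> M"
    have "(\<Sum>\<sigma>\<in>cell_edges K. area \<sigma> * normal_value w \<sigma> K) = (\<Sum>\<sigma>\<in>cell_edges K. F \<sigma> K)"
      by (simp add: F_def mass_flux_eq w_def[abs_def] R_def cong: if_cong)
    moreover have "1 / dt * (?r' K - ?r K) + 1 / vol K * (\<Sum>\<sigma>\<in>cell_edges K. F \<sigma> K) = 0"
      using mass K by (simp add: mass_balance_def)
    ultimately have "(\<Sum>\<sigma>\<in>cell_edges K. area \<sigma> * normal_value w \<sigma> K) = - (vol K / dt * (?r' K - ?r K))"
      using time(1) solid_box_vol_pos[OF cell_solid[OF K]] by (simp add: field_simps)
    then show "vol K / dt * (?p' K * (?r' K - ?r K)) = - (?p' K * (\<Sum>\<sigma>\<in>cell_edges K. area \<sigma> * normal_value w \<sigma> K))"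
      by simp
  qed simp
  also have "\<dots> = (\<Sum>\<sigma>\<in>E. D \<sigma> * w \<sigma> * grad ?p' \<sigma>)"
  proof -
    have "w \<sigma> = 0" if "\<sigma> \<in> ext_edges \<Omega> M" for \<sigma>
      using that grid_edges_Un(2) by (auto simp: w_def)
    from div_grad_duality[OF this, where q = ?p'] show ?thesis by simp
  qed
  also have "\<dots> = (\<Sum>\<sigma>\<in>E. D \<sigma> * R \<sigma> * ?v \<sigma> * grad ?p' \<sigma> - eta * dt * (D \<sigma> * (grad ?p' \<sigma>)^2))"
    by (rule sum.cong) (simp_all add: w_def QE power2_eq_square algebra_simps)
  finally have mass_work: "(\<Sum>K\<in>M. vol K / dt * (?p' K * (?r' K - ?r K))) =
      (\<Sum>\<sigma>\<in>E. D \<sigma> * R \<sigma> * ?v \<sigma> * grad ?p' \<sigma>) - eta * dt * (\<Sum>\<sigma>\<in>E. D \<sigma> * (grad ?p' \<sigma>)^2)"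
    by (simp add: sum_subtractf sum_distrib_left)

  have "(\<Sum>\<sigma>\<in>E. kin \<sigma>) +
      (\<Sum>K\<in>M. vol K / dt * (exp (?p' K) * (?p' K - 1) - exp (?p K) * (?p K - 1))) +
      eps^2 / 2 * (\<Sum>\<sigma>\<in>E. D \<sigma> / dt * ((grad ?p' \<sigma>)^2 - (grad ?p \<sigma>)^2)) \<le> 0"
    using kinetic upwind Lam_work Lam_abs mass_work potential_energy_estimate[OF time(1) poisson poisson']
    by linarith
  then show ?thesis
    unfolding sum_directions kin_def power2_abs .
qed

end
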